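(* Consider the one-sided reflecting random leap on $\{0,1,2,\dots\}$. If $\mu\ge0$, it has no stationary distribution. If $\mu<0$, then the series $\sum_{j=0}^\infty\det(\boldsymbol\Omega_j)$ converges to a finite nonzero number and the (unique) stationary distribution $\boldsymbol\pi=(\pi_0,\pi_1,\dots)$ is \[ \pi_i=\frac{\det(\boldsymbol\Omega_i)}{\sum_{j=0}^\infty\det(\boldsymbol\Omega_j)},\qquad i\in\{0,1,\dots\}. \]
   Context: Fix an integer $k\ge1$ and nonnegative reals $p_1,\dots,p_k,q_1,\dots,q_k$ with $\sum_{j=1}^k(p_j+q_j)=1$, $\sum_{j=1}^k p_j>0$, $\sum_{j=1}^k q_j>0$, and $\gcd\{j:p_j+q_j>0\}=1$. Let $k_p=\max\{j:p_j>0\}$, $k_q=\max\{j:q_j>0\}$, $r=k_p+k_q-1$, $\mu=\sum_{j=1}^k j(p_j-q_j)$. Let $\xi$ be a random variable with $P(\xi=\ell)=p_\ell$, $P(\xi=-\ell)=q_\ell$ ($1\le\ell\le k$). The one-sided reflecting random leap is the Markov chain on $\{0,1,\dots\}$ with $P(i\to0)=P(i+\xi\le0)$ and $P(i\to j)=P(i+\xi=j)$ for $j\ge1$. Reverse characteristic polynomial: $\psi(z)=\sum_{j=0}^{2k-1}\gamma_jz^j$, $\gamma_j=-\sum_{\ell=k-j}^k p_\ell$ for $0\le j\le k-1$, $\gamma_j=\sum_{\ell=j-k+1}^k q_\ell$ for $k\le j\le 2k-1$; it has exactly $r$ nonzero roots counted with multiplicity. Let $y_1,\dots,y_s$ be its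 distinct nonzero roots listed in ascending order of absolute value (ties broken arbitrarily), with multiplicities $r_1,\dots,r_s$. For each $j$ let $\mathbf Y^{(j)}_\infty$ be the matrix with rows indexed by $i=1,2,\dots$ and $r_j$ columns, with entries $(i+1-k_p)^{\ell-1}y_j^{\,i+1-k_p}$ ($0^0=1$), and let $\boldsymbol\Psi$ be the matrix with infinitely many rows consisting of the first $k_p$ columns of $(\mathbf Y^{(1)}_\infty\ \cdots\ \mathbf Y^{(s)}_\infty)$. Half-accordion matrix: for $i\ge0$, $\mathbf H_i$ is the matrix with $k_p$ rows and infinitely many columns $\begin{pmatrix}I_{k_p-1}&0&0&\cdots\\0&\mathbf 1_i^T&0&\cdots\end{pmatrix}$ (i.e. its first $k_p-1$ rows are the first $k_p-1$ unit row vectors, and its last row has ones exactly in columns $k_p,\dots,k_p+i-1$). Let $\boldsymbol\eta_\infty$ be the infinite vector with $\eta_j=\sum_{\ell=j-k_p+1}^{k_q}(\ell-j+k_p)q_\ell$ for $k_p\le j\le r$ and $\eta_j=0$ otherwise. For $i\ge0$ let $\boldsymbol\Omega_i=\begin{pmatrix}\mathbf H_i\boldsymbol\Psi&\mathbf e_{k_p-1}-\mathbf e_{k_p}\\ \boldsymbol\eta_\infty^T\boldsymbol\Psi & \sum_{\ell=1}^{k_p}p_\ell-\sum_{\ell=1}^{k_q}\ell q_\ell\end{pmatrix}$, a $(k_p+1)\times(k_p+1)$ matrix, where $\mathbf e_m$ is the $m$-th unit vector of length $k_p$ and $\mathbf e_{k_p-1}=\mathbf 0$ if $k_p=1$. 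*)

theory Defs
  imports Complex_Main "HOL-Computational_Algebra.Polynomial" "Jordan_Normal_Form.Determinant"
begin

definition xi_prob :: "nat \<Rightarrow> (nat \<Rightarrow> real) \<Rightarrow> (nat \<Rightarrow> real) \<Rightarrow> int \<Rightarrow> real" where
  "xi_prob k p q d =
     (if 1 \<le> d \<and> d \<le> int k then p (nat d)
      else if 1 \<le> - d \<and> - d \<le> int k then q (nat (- d)) else 0)"

definition leap_trans :: "nat \<Rightarrow> (nat \<Rightarrow> real) \<Rightarrow> (nat \<Rightarrow> real) \<Rightarrow> nat \<Rightarrow> nat \<Rightarrow> real" where
  "leap_trans k p q i j =
     (if j = 0 then (\<Sum>d\<in>{- int k..int k}. if int i + d \<le> 0 then xi_prob k p q d else 0)
      else xi_prob k p q (int j - int i))"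

definition leap_stationary :: "nat \<Rightarrow> (nat \<Rightarrow> real) \<Rightarrow> (nat \<Rightarrow> real) \<Rightarrow> (nat \<Rightarrow> real) \<Rightarrow> bool" where
  "leap_stationary k p q \<pi> \<longleftrightarrow>
     (\<forall>i. 0 \<le> \<pi> i) \<and> \<pi> sums 1 \<and>
     (\<forall>j. (\<lambda>i. \<pi> i * leap_trans k p q i j) sums \<pi> j)"

definition kp :: "nat \<Rightarrow> (nat \<Rightarrow> real) \<Rightarrow> nat" where
  "kp k p = Max {j\<in>{1..k}. 0 < p j}"

definition kq :: "nat \<Rightarrow> (nat \<Rightarrow> real) \<Rightarrow> nat" where
  "kq k q = Max {j\<in>{1..k}. 0 < q j}"

definition leap_r :: "nat \<Rightarrow> (nat \<Rightarrow> real) \<Rightarrow> (nat \<Rightarrow> real) \<Rightarrow> nat" where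
  "leap_r k p q = kp k p + kq k q - 1"

definition leap_mu :: "nat \<Rightarrow> (nat \<Rightarrow> real) \<Rightarrow> (nat \<Rightarrow> real) \<Rightarrow> real" where
  "leap_mu k p q = (\<Sum>j=1..k. real j * (p j - q j))"

definition gamma :: "nat \<Rightarrow> (nat \<Rightarrow> real) \<Rightarrow> (nat \<Rightarrow> real) \<Rightarrow> nat \<Rightarrow> real" where
  "gamma k p q j =
     (if j < k then - (\<Sum>l\<in>{k - j..k}. p l)
      else if j < 2 * k then (\<Sum>l\<in>{j - k + 1..k}. q l) else 0)"

definition psi_poly :: "nat \<Rightarrow> (nat \<Rightarrow> real) \<Rightarrow> (nat \<Rightarrow> real) \<Rightarrow> complex poly" where
  "psi_poly k p q = Poly (map (\<lambda>j. complex_of_real (gamma k p q j)) [0..<2 * k])"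

text \<open>Columns of (Y^(1) ... Y^(s)): pairs (y_j, l-1), l = 1..r_j, where r_j is the root multiplicity.\<close>
definition root_cols :: "complex poly \<Rightarrow> complex list \<Rightarrow> (complex \<times> nat) list" where
  "root_cols P ys = concat (map (\<lambda>y. map (\<lambda>l. (y, l)) [0..<order y P]) ys)"

text \<open>Entry (i, c) of Psi, rows i = 1,2,..., columns c = 0..kp-1 (0-based).\<close>
definition Psi_entry :: "nat \<Rightarrow> (nat \<Rightarrow> real) \<Rightarrow> (nat \<Rightarrow> real) \<Rightarrow> complex list \<Rightarrow> nat \<Rightarrow> nat \<Rightarrow> complex" where
  "Psi_entry k p q ys i c =
     (let (y, l) = root_cols (psi_poly k p q) ys ! c;
          e = int i + 1 - int (kp k p)
      in (of_int e) ^ l * y powi e)"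

definition eta :: "nat \<Rightarrow> (nat \<Rightarrow> real) \<Rightarrow> (nat \<Rightarrow> real) \<Rightarrow> nat \<Rightarrow> real" where
  "eta k p q j =
     (if kp k p \<le> j \<and> j \<le> leap_r k p q
      then (\<Sum>l\<in>{j + 1 - kp k p..kq k q}. real (l + kp k p - j) * q l) else 0)"

definition Omega :: "nat \<Rightarrow> (nat \<Rightarrow> real) \<Rightarrow> (nat \<Rightarrow> real) \<Rightarrow> complex list \<Rightarrow> nat \<Rightarrow> complex mat" where
  "Omega k p q ys i =
     (let n = kp k p; Psi = Psi_entry k p q ys in
      mat (n + 1) (n + 1) (\<lambda>(a, b).
        if a < n \<and> b < n then
          (if a + 1 < n then Psi (a + 1) b else (\<Sum>m\<in>{n..<n + i}. Psi m b))
        else if a < n then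
          (if a + 2 = n then 1 else if a + 1 = n then -1 else 0)
        else if b < n then
          (\<Sum>j\<in>{n..leap_r k p q}. complex_of_real (eta k p q j) * Psi j b)
        else complex_of_real ((\<Sum>l=1..n. p l) - (\<Sum>l=1..kq k q. real l * q l))))"

end

theory Submission
  imports "HOL-Complex_Analysis.Residue_Theorem" Defs
begin

text \<open>
  A vector \<open>\<sigma>\<close> is invariant iff the probability flow across every cut \<open>{0..<i} | {i..}\<close> balances. Extended by
  zero to negative indices, \<open>\<sigma>\<close> then satisfies the linear recurrence with characteristic polynomial
  \<open>\<psi>\<close>. Summing the cut equations of a stationary distribution over all \<open>i\<close> forces \<open>\<mu> < 0\<close>.

  If \<open>\<sigma>\<close> is a summable complex invariant vector, then so is \<open>|\<sigma>|\<close>, because the transition operator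
  contracts the \<open>l\<^sup>1\<close> norm and preserves mass; as state 0 is accessible from everywhere, \<open>\<sigma> 0 = 0\<close> implies
  \<open>\<sigma> = 0\<close>. So summable invariant vectors form a space of dimension at most one, and each nonzero one is
  a multiple of the stationary distribution.

  For \<open>\<mu> < 0\<close>, Rouche's theorem applied to \<open>(1 - z) \<psi>(z) = z^k - E z^(k - \<xi>)\<close> on a circle of radius slightly
  below 1 gives at least \<open>kp\<close> nonzero roots inside the unit disc, so all columns of \<open>\<Psi>\<close> decay geometrically.
  The rows of \<open>\<Omega> i\<close> other than the one depending on \<open>i\<close> say that a combination of these columns is the
  sequence of increments \<open>\<sigma> e - \<sigma> (e - 1)\<close> of an invariant \<open>\<sigma>\<close>, whose value \<open>\<sigma> i\<close> is what the remaining row computes.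
  The cofactors of that row are such a combination, hence \<open>i \<mapsto> det (\<Omega> i)\<close> is invariant and summable.
  If \<open>det (\<Omega> 0)\<close> vanished, a kernel vector would give an invariant \<open>\<sigma>\<close> with \<open>\<sigma> 0 = 0\<close>, thus \<open>\<sigma> = 0\<close>,
  contradicting the linear independence of the columns.
\<close>

subsection \<open>Exponential polynomials and root counting\<close>

text \<open>Induction on \<open>sz\<close>, which counts coefficient slots. The operator f (e + 1) -
  y0 f e lowers it strictly, as leading coefficients cancel at \<open>y0\<close>; at any other
  \<open>y\<close> it multiplies the leading coefficient by \<open>y - y0\<close>. So only
  \<open>P y0\<close> could survive, and it has infinitely many roots.\<close>

lemma exp_poly_independent:
  fixes P :: "'a::field_char_0 \<Rightarrow> 'a poly"
  assumes "finite Y" "0 \<notin> Y"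
    and "\<And>e::nat. e \<ge> 1 \<Longrightarrow> (\<Sum>y\<in>Y. poly (P y) (of_nat e) * y ^ e) = 0"
    and "y \<in> Y"
  shows "P y = 0"
proof -
  define sz where "sz P = (\<Sum>y\<in>Y. if P y = 0 then 0 else degree (P y) + 1)" for P :: "'a \<Rightarrow> 'a poly"
  have "\<forall>y\<in>Y. P y = 0"
    if "\<And>e::nat. e \<ge> 1 \<Longrightarrow> (\<Sum>y\<in>Y. poly (P y) (of_nat e) * y ^ e) = 0" for P
    using that
  proof (induction "sz P" arbitrary: P rule: less_induct)
    case less
    show ?case
    proof (rule ccontr)
      assume "\<not> (\<forall>y\<in>Y. P y = 0)"
      then obtain y0 where y0: "y0 \<in> Y" "P y0 \<noteq> 0" by auto
      \<comment> \<open>\<open>Q\<close> describes the sequence \<open>f (e + 1) - y0 f e\<close>, where the degree drops at \<open>y0\<close> only.\<close>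
      define Q where "Q y = Polynomial.smult y (pcompose (P y) [:1, 1:]) - Polynomial.smult y0 (P y)" for y
      have polyQ: "poly (Q y) x = y * poly (P y) (x + 1) - y0 * poly (P y) x" for x y
        by (simp add: Q_def poly_pcompose add.commute)
      have Q0: "P y = 0 \<Longrightarrow> Q y = 0" for y by (simp add: Q_def)
      have lead: "lead_coeff (pcompose (P y) [:1, 1:]) = lead_coeff (P y)" for y
        by (subst lead_coeff_comp) auto
      have cd: "coeff (pcompose (P y) [:1, 1:]) (degree (P y)) = lead_coeff (P y)" for y
        using lead[of y] by (simp add: degree_pcompose)
      have degQ: "degree (Q y) \<le> degree (P y)" for y
        unfolding Q_def by (intro degree_diff_le) (auto intro: order_trans[OF degree_smult_le] simp: degree_pcompose)
      have "sz Q < sz P" unfolding sz_def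
      proof (rule sum_strict_mono_ex1[OF assms(1)])
        show "\<forall>y\<in>Y. (if Q y = 0 then 0 else degree (Q y) + 1) \<le> (if P y = 0 then 0 else degree (P y) + 1)"
          using Q0 degQ by auto
        have "coeff (Q y0) (degree (P y0)) = 0" by (simp add: Q_def cd)
        then have "Q y0 = 0 \<or> degree (Q y0) < degree (P y0)"
          using degQ[of y0] by (metis le_neq_implies_less leading_coeff_0_iff)
        then show "\<exists>y\<in>Y. (if Q y = 0 then 0 else degree (Q y) + 1) < (if P y = 0 then 0 else degree (P y) + 1)"
          using y0 by (intro bexI[of _ y0]) auto
      qed
      moreover have "(\<Sum>y\<in>Y. poly (Q y) (of_nat e) * y ^ e) = 0" if "e \<ge> 1" for e
      proof -
        have "(\<Sum>y\<in>Y. poly (Q y) (of_nat e) * y ^ e) =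
          (\<Sum>y\<in>Y. poly (P y) (of_nat (Suc e)) * y ^ Suc e) - y0 * (\<Sum>y\<in>Y. poly (P y) (of_nat e) * y ^ e)"
          by (simp add: polyQ sum_distrib_left sum_subtractf[symmetric] algebra_simps)
        then show ?thesis using less.prems[of e] less.prems[of "Suc e"] that by simp
      qed
      ultimately have Qz: "\<forall>y\<in>Y. Q y = 0" by (rule less.hyps)
      have Pz: "P y = 0" if "y \<in> Y" "y \<noteq> y0" for y
      proof -
        have "coeff (Q y) (degree (P y)) = (y - y0) * lead_coeff (P y)"
          by (simp add: Q_def cd algebra_simps)
        then show ?thesis using Qz that by simp
      qed
      have root: "poly (P y0) (of_nat e) = 0" if "e \<ge> 1" for e
      proof -
        have "(\<Sum>y\<in>Y. poly (P y) (of_nat e) * y ^ e) = (\<Sum>y\<in>{y0}. poly (P y) (of_nat e) * y ^ e)"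
          by (rule sum.mono_neutral_right) (use assms(1) y0 Pz in auto)
        then show ?thesis using less.prems[of e] that y0 assms(2) by auto
      qed
      have "infinite (of_nat ` {1::nat..} :: 'a set)"
        by (subst finite_image_iff) (auto simp: inj_on_def infinite_Ici)
      moreover have "of_nat ` {1::nat..} \<subseteq> {x. poly (P y0) x = 0}" using root by auto
      ultimately show False using poly_roots_finite[OF y0(2)] finite_subset by blast
    qed
  qed
  then show ?thesis using assms by blast
qed

text \<open>Collecting the pairs with a common base \<open>y\<close> into one polynomial
  \<open>P y\<close> reduces this to \<open>exp_poly_independent\<close>.\<close>

lemma exp_monomials_independent:
  fixes C :: "'a::field_char_0 \<times> nat \<Rightarrow> 'a"
  assumes "finite S" "\<And>y l. (y, l) \<in> S \<Longrightarrow> y \<noteq> 0"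
    and "\<And>e::nat. e \<ge> 1 \<Longrightarrow> (\<Sum>(y, l)\<in>S. C (y, l) * (of_nat e ^ l * y ^ e)) = 0"
    and "(y, l) \<in> S"
  shows "C (y, l) = 0"
proof -
  define P where "P y = (\<Sum>l\<in>{l. (y, l) \<in> S}. monom (C (y, l)) l)" for y
  have fin: "finite {l. (y, l) \<in> S}" for y
    by (rule finite_subset[of _ "snd ` S"]) (use assms(1) in force)+
  have S: "S = Sigma (fst ` S) (\<lambda>y. {l. (y, l) \<in> S})" by force
  have "(\<Sum>y\<in>fst ` S. poly (P y) (of_nat e) * y ^ e) = 0" if "e \<ge> 1" for e :: nat
  proof -
    have "(\<Sum>y\<in>fst ` S. poly (P y) (of_nat e) * y ^ e)
        = (\<Sum>y\<in>fst ` S. \<Sum>l\<in>{l. (y, l) \<in> S}. C (y, l) * (of_nat e ^ l * y ^ e))"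
      by (simp add: P_def poly_sum poly_monom sum_distrib_right mult.assoc)
    also have "\<dots> = (\<Sum>(y, l)\<in>S. C (y, l) * (of_nat e ^ l * y ^ e))"
      using fin assms(1) by (subst (3) S, subst sum.Sigma) auto
    finally show ?thesis using assms(3) that by simp
  qed
  then have "P y = 0"
    using assms by (intro exp_poly_independent[of "fst ` S"]) force+
  moreover have "coeff (P y) l = C (y, l)"
    using fin assms(4) by (simp add: P_def coeff_sum sum.delta')
  ultimately show ?thesis by simp
qed

text \<open>For exponents \<open>l\<close> below the multiplicity of \<open>y\<close>, the sequence
  j ^ l * y ^ j solves the recurrence with characteristic polynomial \<open>P\<close>. The shift
  \<open>a\<close> lets the window of the recurrence start anywhere.\<close>

lemma multiple_root_recurrence:
  fixes P :: "'a::field_char_0 poly"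
  assumes "[:- y, 1:] ^ Suc l dvd P" "degree P < N"
  shows "(\<Sum>j<N. coeff P j * ((of_nat j + a) ^ l * y ^ j)) = 0"
  using assms
proof (induction l arbitrary: P)
  case 0
  then have "poly P y = 0" by (simp add: poly_eq_0_iff_dvd)
  moreover have "poly P y = (\<Sum>j<N. coeff P j * y ^ j)"
    unfolding poly_altdef by (rule sum.mono_neutral_left) (use 0 in \<open>auto simp: coeff_eq_0\<close>)
  ultimately show ?case by simp
next
  case (Suc l)
  \<comment> \<open>\<open>z d/dz + a\<close> multiplies the \<open>j\<close>-th coefficient by \<open>j + a\<close> and lowers root multiplicities by at most one.\<close>
  define Q where "Q = [:0, 1:] * pderiv P + Polynomial.smult a P"
  have cQ: "coeff Q j = (of_nat j + a) * coeff P j" for j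
    by (cases j) (auto simp: Q_def coeff_pderiv algebra_simps coeff_pCons)
  have "[:- y, 1:] ^ Suc l dvd pderiv P"
  proof -
    obtain R where R: "P = [:- y, 1:] ^ Suc (Suc l) * R" using Suc.prems(1) by (auto elim: dvdE)
    have "pderiv P = [:- y, 1:] ^ Suc (Suc l) * pderiv R + R * (Polynomial.smult (of_nat (Suc (Suc l))) ([:- y, 1:] ^ Suc l) * pderiv [:- y, 1:])"
      unfolding R by (simp only: pderiv_mult pderiv_power_Suc)
    then show ?thesis
      by (simp only:) (intro dvd_add dvd_mult2[OF le_imp_power_dvd] dvd_mult[OF dvd_mult2[OF dvd_smult[OF dvd_refl]]], simp)
  qed
  moreover have "[:- y, 1:] ^ Suc l dvd P"
    using Suc.prems(1) by (meson dvd_trans le_imp_power_dvd lessI less_imp_le)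
  ultimately have "[:- y, 1:] ^ Suc l dvd Q" unfolding Q_def by (intro dvd_add dvd_mult dvd_smult)
  moreover have "degree Q < N"
    using Suc.prems(2) by (intro le_less_trans[of "degree Q" "degree P"] degree_le) (auto simp: cQ coeff_eq_0)
  ultimately have "(\<Sum>j<N. coeff Q j * ((of_nat j + a) ^ l * y ^ j)) = 0" by (rule Suc.IH)
  then show ?case by (simp add: cQ algebra_simps)
qed

section \<open>Zeros of polynomials in a disc\<close>

lemma zorder_poly:
  fixes P :: "complex poly"
  assumes "P \<noteq> 0"
  shows "zorder (poly P) z = int (order z P)"
proof -
  obtain R where R: "P = [:- z, 1:] ^ order z P * R" "\<not> [:- z, 1:] dvd R"
    using order_decomp[OF assms] by blast
  show ?thesis
  proof (rule zorder_eqI[of UNIV z "poly R"])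
    show "poly R z \<noteq> 0" using R(2) by (simp add: poly_eq_0_iff_dvd)
    show "poly P w = poly R w * (w - z) powi int (order z P)" for w
      by (subst R(1)) (simp add: poly_power)
  qed (auto intro: holomorphic_intros)
qed

text \<open>The circle winds once around inner points and not at all around outer ones, and the
  strict inequality keeps zeros off the circle. Rouche's weighted sums thus become sums of
  multiplicities over the open disc.\<close>

lemma Rouche_poly_disc:
  fixes f g :: "complex poly"
  assumes "0 < \<rho>" and less: "\<And>z. cmod z = \<rho> \<Longrightarrow> cmod (poly g z) < cmod (poly f z)"
  shows "(\<Sum>z | cmod z < \<rho> \<and> poly (f + g) z = 0. order z (f + g)) = (\<Sum>z | cmod z < \<rho> \<and> poly f z = 0. order z f)"
proof -
  define c where "c = circlepath 0 \<rho>"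
  have pim: "path_image c = sphere 0 \<rho>" using assms(1) by (simp add: c_def)
  have "complex_of_real \<rho> \<in> sphere 0 \<rho>" using assms(1) by simp
  then have l\<rho>: "cmod (poly g \<rho>) < cmod (poly f \<rho>)" using less by simp
  then have f0: "f \<noteq> 0" by auto
  have fg0: "f + g \<noteq> 0"
  proof
    assume "f + g = 0"
    then have "g = - f" by (simp add: add_eq_0_iff)
    then show False using l\<rho> by simp
  qed
  have conv: "(\<Sum>z\<in>{z\<in>UNIV. poly h z = 0}. winding_number c z * zorder (poly h) z)
      = of_nat (\<Sum>z | cmod z < \<rho> \<and> poly h z = 0. order z h)"
    if "h \<noteq> 0" "\<And>z. cmod z = \<rho> \<Longrightarrow> poly h z \<noteq> 0" for h
  proof -
    have w: "winding_number c z = (if cmod z < \<rho> then 1 else 0)" if "poly h z = 0" for z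
    proof (cases "cmod z < \<rho>")
      case True then show ?thesis by (simp add: c_def winding_number_circlepath)
    next
      case False
      then have "z \<notin> cball 0 \<rho>" using \<open>\<And>z. cmod z = \<rho> \<Longrightarrow> poly h z \<noteq> 0\<close> \<open>poly h z = 0\<close> by force
      then have "winding_number c z = 0"
        using assms(1) unfolding c_def
        by (intro winding_number_zero_outside[of _ "cball 0 \<rho>"]) auto
      then show ?thesis using False by simp
    qed
    have "(\<Sum>z\<in>{z\<in>UNIV. poly h z = 0}. winding_number c z * zorder (poly h) z)
       = (\<Sum>z\<in>{z. cmod z < \<rho> \<and> poly h z = 0}. of_nat (order z h))"
      using poly_roots_finite[OF that(1)]
      by (intro sum.mono_neutral_cong_right) (auto simp: w zorder_poly[OF that(1)])
    then show ?thesis by simp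
  qed
  have "(\<Sum>z\<in>{z\<in>UNIV. poly f z + poly g z = 0}. winding_number c z * zorder (\<lambda>z. poly f z + poly g z) z)
      = (\<Sum>z\<in>{z\<in>UNIV. poly f z = 0}. winding_number c z * zorder (poly f) z)"
  proof (rule Rouche_theorem)
    show "finite {z\<in>UNIV. poly f z + poly g z = 0}" "finite {z\<in>UNIV. poly f z = 0}"
      using poly_roots_finite[OF f0] poly_roots_finite[OF fg0] by simp_all
    show "\<forall>z\<in>path_image c. cmod (poly g z) < cmod (poly f z)" using less by (auto simp: pim)
  qed (auto simp: c_def intro: holomorphic_intros)
  moreover have "(\<lambda>z. poly f z + poly g z) = poly (f + g)" by auto
  ultimately have "(\<Sum>z\<in>{z\<in>UNIV. poly (f + g) z = 0}. winding_number c z * zorder (poly (f + g)) z)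
      = (\<Sum>z\<in>{z\<in>UNIV. poly f z = 0}. winding_number c z * zorder (poly f) z)"
    by simp
  moreover have "poly f z \<noteq> 0" "poly (f + g) z \<noteq> 0" if "cmod z = \<rho>" for z
    using less[OF that] by (auto simp: add_eq_0_iff)
  ultimately have "complex_of_nat (\<Sum>z | cmod z < \<rho> \<and> poly (f + g) z = 0. order z (f + g)) = of_nat (\<Sum>z | cmod z < \<rho> \<and> poly f z = 0. order z f)"
    using conv[OF f0] conv[OF fg0] by simp
  then show ?thesis using of_nat_eq_iff by blast
qed

section \<open>Summation over triangles and a growth bound\<close>

lemma sum_triangle_swap:
  fixes f :: "nat \<Rightarrow> nat \<Rightarrow> 'a::comm_monoid_add"
  shows "(\<Sum>i=1..N. \<Sum>l=i..N. f i l) = (\<Sum>l=1..N. \<Sum>i=1..l. f i l)"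
proof -
  have "(\<Sum>(i, l)\<in>Sigma {1..N} (\<lambda>i. {i..N}). f i l) = (\<Sum>(l, i)\<in>Sigma {1..N} (\<lambda>l. {1..l}). f i l)"
    by (rule sum.reindex_bij_witness[of _ "\<lambda>(a, b). (b, a)" "\<lambda>(a, b). (b, a)"]) auto
  then show ?thesis by (simp add: sum.Sigma)
qed

text \<open>Each extra factor \<open>e\<close> is absorbed by a slightly larger base; hence
  \<open>\<theta>\<close> varies in the induction, and \<open>\<theta>'\<close> leaves room for one
  more factor.\<close>

lemma poly_exp_bound:
  fixes r \<theta> :: real
  assumes "0 \<le> r" "r < \<theta>"
  shows "\<exists>K. \<forall>e::nat. real e ^ l * r ^ e \<le> K * \<theta> ^ e"
  using assms(2)
proof (induction l arbitrary: \<theta>)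
  case 0
  then show ?case using assms(1) by (intro exI[of _ 1]) (auto intro: power_mono)
next
  case (Suc l)
  obtain \<theta>' where \<theta>': "r < \<theta>'" "\<theta>' < \<theta>" using dense[OF Suc.prems] by blast
  have pos: "0 < \<theta>'" "0 < \<theta>" using \<theta>' assms(1) by auto
  obtain K where K: "\<And>e. real e ^ l * r ^ e \<le> K * \<theta>' ^ e" using Suc.IH[OF \<theta>'(1)] by blast
  \<comment> \<open>At \<open>e = 0\<close> the left-hand side of the bound is nonnegative and the
    power of \<open>\<theta>'\<close> is 1.\<close>
  have K0: "0 \<le> K" using order_trans[OF _ K[of 0]] by (cases l) (auto simp: zero_power)
  have "(\<lambda>e. of_nat e * (\<theta>' / \<theta>) ^ e) \<longlonglongrightarrow> 0"
    using pos \<theta>' by (intro powser_times_n_limit_0) auto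
  then obtain M where M: "\<And>e. \<bar>of_nat e * (\<theta>' / \<theta>) ^ e\<bar> \<le> M"
    using convergent_imp_Bseq[of "\<lambda>e. of_nat e * (\<theta>' / \<theta>) ^ e"] unfolding Bseq_def convergent_def by fastforce
  show ?case
  proof (intro exI[of _ "K * M"] allI)
    fix e :: nat
    have "real e ^ Suc l * r ^ e = real e * (real e ^ l * r ^ e)" by simp
    also have "\<dots> \<le> real e * (K * \<theta>' ^ e)" by (intro mult_left_mono K) auto
    also have "\<dots> = K * (real e * (\<theta>' / \<theta>) ^ e) * \<theta> ^ e" using pos by (simp add: power_divide)
    also have "\<dots> \<le> K * M * \<theta> ^ e"
      using M[of e] K0 pos by (intro mult_right_mono mult_left_mono) auto
    finally show "real e ^ Suc l * r ^ e \<le> K * M * \<theta> ^ e" .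
  qed
qed

section \<open>Ordering and multiplicities of the columns\<close>

lemma fst_snd_root_cols:
  assumes "(y, l) \<in> set (root_cols P ys)"
  shows "y \<in> set ys" "l < order y P"
  using assms by (auto simp: root_cols_def)

lemma distinct_root_cols: "distinct ys \<Longrightarrow> distinct (root_cols P ys)"
  unfolding root_cols_def
  by (induction ys) (auto simp: distinct_map inj_on_def)

lemma sorted_root_cols:
  assumes "sorted_wrt (\<lambda>a b. cmod a \<le> cmod b) ys"
  shows "sorted_wrt (\<lambda>a b. cmod (fst a) \<le> cmod (fst b)) (root_cols P ys)"
  using assms unfolding root_cols_def
  by (induction ys) (auto simp: sorted_wrt_append sorted_wrt_map sorted_wrt_true)

text \<open>Turns a count of roots with multiplicity, as Rouche's theorem supplies it, into a count
  of columns.\<close>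

lemma length_filter_root_cols:
  assumes "distinct ys"
  shows "length (filter (\<lambda>c. Q (fst c)) (root_cols P ys)) = (\<Sum>y | y \<in> set ys \<and> Q y. order y P)"
proof -
  have "length (filter (\<lambda>c. Q (fst c)) (root_cols P ys)) = (\<Sum>y\<leftarrow>ys. if Q y then order y P else 0)"
    unfolding root_cols_def by (induction ys) (auto simp: filter_map o_def)
  also have "\<dots> = (\<Sum>y\<in>set ys. if Q y then order y P else 0)"
    using assms by (rule sum_list_distinct_conv_sum_set)
  also have "\<dots> = (\<Sum>y | y \<in> set ys \<and> Q y. order y P)"
    by (rule sum.mono_neutral_cong_right) auto
  finally show ?thesis .
qed

text \<open>If the key at \<open>c\<close> were at least \<open>t\<close>, so would be all later
  ones, leaving at most \<open>c < N\<close> entries below \<open>t\<close>. This places the small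
  roots in the first columns.\<close>

lemma sorted_wrt_prefix_less:
  fixes key :: "'a \<Rightarrow> 'b::linorder"
  assumes "sorted_wrt (\<lambda>a b. key a \<le> key b) xs" "N \<le> length (filter (\<lambda>x. key x < t) xs)" "c < N"
  shows "c < length xs" "key (xs ! c) < t"
proof -
  show c: "c < length xs" using assms(2,3) length_filter_le[of "\<lambda>x. key x < t" xs] by linarith
  show "key (xs ! c) < t"
  proof (rule ccontr)
    assume "\<not> key (xs ! c) < t"
    then have ge: "\<not> key (xs ! i) < t" if "c \<le> i" "i < length xs" for i
      using that sorted_wrt_nth_less[OF assms(1), of c i] c by (cases "i = c") auto
    have "length (filter (\<lambda>x. key x < t) xs) = card {i. i < length xs \<and> key (xs ! i) < t}"
      by (rule length_filter_conv_card)
    also have "\<dots> \<le> card {..<c}" using ge by (intro card_mono) (auto simp: not_le[symmetric])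
    finally show False using assms(2,3) by simp
  qed
qed

subsection \<open>Invariant vectors of the random leap\<close>

definition leap_cdf :: "nat \<Rightarrow> (nat \<Rightarrow> real) \<Rightarrow> (nat \<Rightarrow> real) \<Rightarrow> int \<Rightarrow> real" where
  "leap_cdf k p q d = (\<Sum>x\<in>{- int k..d}. xi_prob k p q x)"

text \<open>The net flow from \<open>{i..}\<close> to \<open>{0..<i}\<close>: \<open>gamma k p q j\<close> is the probability of jumping down across
  the cut from \<open>i - k + j\<close> if \<open>j \<ge> k\<close>, and minus that of jumping up across it if \<open>j < k\<close>.\<close>

definition cut_flow :: "nat \<Rightarrow> (nat \<Rightarrow> real) \<Rightarrow> (nat \<Rightarrow> real) \<Rightarrow> (int \<Rightarrow> 'a::real_normed_field) \<Rightarrow> int \<Rightarrow> 'a" where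
  "cut_flow k p q S i = (\<Sum>j<2 * k. of_real (gamma k p q j) * S (i - int k + int j))"

definition zero_ext :: "(nat \<Rightarrow> 'a::zero) \<Rightarrow> int \<Rightarrow> 'a" where
  "zero_ext f e = (if e < 0 then 0 else f (nat e))"

text \<open>Neither sign nor total mass is prescribed and the field is general, so that real
  probability vectors and complex determinants are both covered.\<close>

definition leap_invariant :: "nat \<Rightarrow> (nat \<Rightarrow> real) \<Rightarrow> (nat \<Rightarrow> real) \<Rightarrow> (nat \<Rightarrow> 'a::real_normed_field) \<Rightarrow> bool" where
  "leap_invariant k p q f \<longleftrightarrow> (\<forall>j. (\<lambda>i. f i * of_real (leap_trans k p q i j)) sums f j)"

locale random_leap =
  fixes k :: nat and p q :: "nat \<Rightarrow> real"
  assumes k_pos: "1 \<le> k"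
    and nonneg: "\<forall>j\<in>{1..k}. 0 \<le> p j \<and> 0 \<le> q j"
    and total: "(\<Sum>j=1..k. p j + q j) = 1"
    and p_pos: "(\<Sum>j=1..k. p j) > 0"
    and q_pos: "(\<Sum>j=1..k. q j) > 0"
begin

abbreviation "xi \<equiv> xi_prob k p q"
abbreviation "T \<equiv> leap_trans k p q"
abbreviation "F \<equiv> leap_cdf k p q"
abbreviation "\<gamma> \<equiv> gamma k p q"
abbreviation "flow \<equiv> cut_flow k p q"
abbreviation "np \<equiv> kp k p"
abbreviation "nq \<equiv> kq k q"

section \<open>The distribution function of the step\<close>

lemma xi_nonneg: "0 \<le> xi d"
  using nonneg by (force simp: xi_prob_def)

lemma xi_outside: "d < - int k \<or> int k < d \<Longrightarrow> xi d = 0"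
  by (auto simp: xi_prob_def)

lemma cdf_step: "F (d + 1) = F d + xi (d + 1)"
proof (cases "- int k \<le> d + 1")
  case True
  then have "{- int k..d + 1} = insert (d + 1) {- int k..d}" by auto
  then show ?thesis by (simp add: leap_cdf_def)
next
  case False
  then show ?thesis by (simp add: leap_cdf_def xi_outside)
qed

lemma cdf_mono: "d \<le> d' \<Longrightarrow> F d \<le> F d'"
  unfolding leap_cdf_def by (rule sum_mono2) (auto simp: xi_nonneg)

lemma cdf_nonneg: "0 \<le> F d"
  unfolding leap_cdf_def by (simp add: sum_nonneg xi_nonneg)

lemma cdf_low: "d < - int k \<Longrightarrow> F d = 0"
  by (simp add: leap_cdf_def)

lemma cdf_neg: "F (- int t) = (\<Sum>l\<in>{t..k}. q l)" if "1 \<le> t"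
proof -
  have "F (- int t) = (\<Sum>x\<in>{- int k..- int t}. q (nat (- x)))"
    unfolding leap_cdf_def using that by (intro sum.cong) (auto simp: xi_prob_def)
  also have "\<dots> = (\<Sum>l\<in>{t..k}. q l)"
    by (rule sum.reindex_bij_witness[of _ "\<lambda>l. - int l" "\<lambda>x. nat (- x)"]) auto
  finally show ?thesis .
qed

lemma cdf_0: "F 0 = (\<Sum>l=1..k. q l)"
  using cdf_step[of "-1"] cdf_neg[of 1] by (simp add: xi_prob_def)

lemma cdf_nonneg_arg: "F (int t) = (\<Sum>l=1..k. q l) + (\<Sum>l\<in>{1..min t k}. p l)"
proof (induction t)
  case 0 then show ?case by (simp add: cdf_0)
next
  case (Suc t)
  have "F (int (Suc t)) = F (int t) + xi (int (Suc t))"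
    using cdf_step[of "int t"] by (simp add: add.commute)
  moreover have "(\<Sum>l\<in>{1..min (Suc t) k}. p l) = (\<Sum>l\<in>{1..min t k}. p l) + xi (int (Suc t))"
    by (cases "Suc t \<le> k") (auto simp: xi_prob_def min_absorb1 min_absorb2 nat_add_distrib)
  ultimately show ?case using Suc by simp
qed

lemma total_split: "(\<Sum>l=1..k. q l) + (\<Sum>l=1..k. p l) = 1"
  using total by (simp add: sum.distrib)

lemma cdf_high: "int k \<le> d \<Longrightarrow> F d = 1"
proof -
  assume "int k \<le> d"
  then have "min (nat d) k = k" "int (nat d) = d" by auto
  then show ?thesis using cdf_nonneg_arg[of "nat d"] total_split by simp
qed

lemma cdf_le_1: "F d \<le> 1"
  using cdf_mono[of d "max d (int k)"] cdf_high[of "max d (int k)"] by simp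

text \<open>From \<open>i - k + j\<close> the chain lands below \<open>i\<close> iff the step is at
  most \<open>k - 1 - j\<close>. If \<open>j < k\<close> the start is already below
  \<open>i\<close>, and subtracting 1 leaves minus the probability of jumping up.\<close>

lemma gamma_eq_cdf: "\<gamma> j = F (int k - 1 - int j) - (if j < k then 1 else 0)"
proof (cases "j < k")
  case True
  define t where "t = k - 1 - j"
  have t: "int k - 1 - int j = int t" "t < k" "k - j = Suc t" using True by (auto simp: t_def)
  have "(\<Sum>l=1..k. p l) = (\<Sum>l=1..t. p l) + (\<Sum>l\<in>{Suc t..k}. p l)"
    using sum.ub_add_nat[of 1 t p "k - t"] t(2) by simp
  then show ?thesis
    using True t cdf_nonneg_arg[of t] total_split by (simp add: gamma_def)
next
  case False
  then have eq: "int k - 1 - int j = - int (j - k + 1)" by simp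
  show ?thesis unfolding eq using False cdf_neg[of "j - k + 1"]
    by (auto simp: gamma_def)
qed

section \<open>Transition matrix and cut equations\<close>

lemma trans_0: "T i 0 = F (- int i)"
proof -
  have "T i 0 = (\<Sum>d\<in>{- int k..int k} \<inter> {d. int i + d \<le> 0}. xi d)"
    unfolding leap_trans_def by (simp add: sum.inter_restrict)
  also have "{- int k..int k} \<inter> {d. int i + d \<le> 0} = {- int k..- int i}" by auto
  finally show ?thesis by (simp add: leap_cdf_def)
qed

lemma trans_nonneg: "0 \<le> T i j"
  by (cases j) (auto simp: trans_0 cdf_nonneg, simp add: leap_trans_def xi_nonneg)

lemma trans_far: "j + k < i \<Longrightarrow> T i j = 0"
  by (cases j) (auto simp: trans_0 cdf_low, simp add: leap_trans_def xi_outside)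

text \<open>Reflection sends every landing point at or below 0 to state 0, so the sum is the
  probability of a step of size at most \<open>s - i\<close>.\<close>

lemma row_sum: "(\<Sum>j<Suc s. T i j) = F (int s - int i)"
proof (induction s)
  case 0 then show ?case by (simp add: trans_0)
next
  case (Suc s)
  have "(\<Sum>j<Suc (Suc s). T i j) = F (int s - int i) + T i (Suc s)" using Suc by simp
  also have "\<dots> = F (int (Suc s) - int i)"
    using cdf_step[of "int s - int i"] by (simp add: leap_trans_def algebra_simps)
  finally show ?case .
qed

text \<open>No downward step exceeds \<open>k\<close>, so only states up to \<open>j + k\<close>
  feed state \<open>j\<close>.\<close>

lemma invariant_iff_finite:
  "leap_invariant k p q f \<longleftrightarrow> (\<forall>j. \<forall>M>j + k. (\<Sum>i<M. f i * of_real (T i j)) = f j)"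
proof -
  have s: "(\<lambda>i. f i * of_real (T i j)) sums (\<Sum>i<M. f i * of_real (T i j))" if "j + k < M" for j M
    by (rule sums_finite) (use that in \<open>auto simp: trans_far\<close>)
  show ?thesis unfolding leap_invariant_def
  proof (intro iffI allI impI)
    fix j M assume "\<forall>j. (\<lambda>i. f i * of_real (T i j)) sums f j" "j + k < M"
    then show "(\<Sum>i<M. f i * of_real (T i j)) = f j" using s sums_unique2 by blast
  next
    fix j assume "\<forall>j. \<forall>M>j + k. (\<Sum>i<M. f i * of_real (T i j)) = f j"
    then show "(\<lambda>i. f i * of_real (T i j)) sums f j" using s[of j "Suc (j + k)"] by (metis lessI)
  qed
qed

lemma cut_zero_ext:
  "flow (zero_ext f) (int (Suc s)) = (\<Sum>i<Suc s + k. f i * of_real (F (int s - int i))) - (\<Sum>i<Suc s. f i)"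
proof -
  define g where "g e = F (int s - e) - (if e \<le> int s then 1 else 0)" for e :: int
  define h where "h e = of_real (g e) * zero_ext f e" for e
  have "flow (zero_ext f) (int (Suc s)) = (\<Sum>j<2 * k. h (int (Suc s) - int k + int j))"
    unfolding cut_flow_def h_def g_def gamma_eq_cdf by (intro sum.cong) (auto simp: algebra_simps)
  also have "\<dots> = (\<Sum>e\<in>{int (Suc s) - int k..<int (Suc s) + int k}. h e)"
    by (rule sum.reindex_bij_witness[of _ "\<lambda>e. nat (e - (int (Suc s) - int k))" "\<lambda>j. int (Suc s) - int k + int j"]) auto
  \<comment> \<open>Indices below the window add nothing, since there \<open>F\<close> is 1 and
    \<open>g\<close> vanishes. The step after this one drops the negative indices, where the
    extension is zero.\<close>
  also have "\<dots> = (\<Sum>e\<in>{min 0 (int (Suc s) - int k)..<int (Suc s) + int k}. h e)"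
    by (rule sum.mono_neutral_left) (auto simp: h_def g_def zero_ext_def cdf_high)
  also have "\<dots> = (\<Sum>e\<in>{0..<int (Suc s) + int k}. h e)"
    by (rule sum.mono_neutral_right) (auto simp: h_def zero_ext_def)
  also have "\<dots> = (\<Sum>i<Suc s + k. h (int i))"
    by (rule sum.reindex_bij_witness[of _ "\<lambda>i. int i" nat]) auto
  also have "\<dots> = (\<Sum>i<Suc s + k. f i * of_real (F (int s - int i)) - (if i < Suc s then f i else 0))"
    by (intro sum.cong) (auto simp: h_def g_def zero_ext_def algebra_simps)
  also have "\<dots> = (\<Sum>i<Suc s + k. f i * of_real (F (int s - int i))) - (\<Sum>i<Suc s + k. if i < Suc s then f i else 0)"
    by (rule sum_subtractf)
  also have "(\<Sum>i<Suc s + k. if i < Suc s then f i else 0) = (\<Sum>i<Suc s. f i)"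
    by (rule sum.mono_neutral_cong_right) auto
  finally show ?thesis .
qed

lemma sum_invariance:
  "(\<Sum>j<Suc s. \<Sum>i<Suc s + k. f i * of_real (T i j)) = (\<Sum>i<Suc s + k. f i * of_real (F (int s - int i)))"
  unfolding row_sum[symmetric] of_real_sum sum_distrib_left by (rule sum.swap)

text \<open>The cut equation at \<open>Suc s\<close> is the sum of the invariance equations for the
  states \<open>0..s\<close>; conversely, the difference of two consecutive cut equations is a
  single invariance equation.\<close>

lemma invariant_iff_cut:
  "leap_invariant k p q f \<longleftrightarrow> (\<forall>s. flow (zero_ext f) (int (Suc s)) = 0)"
proof
  assume "leap_invariant k p q f"
  then have inv: "(\<Sum>i<Suc s + k. f i * of_real (T i j)) = f j" if "j < Suc s" for j s
    using that unfolding invariant_iff_finite by (metis add_less_mono1)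
  have "(\<Sum>j<Suc s. \<Sum>i<Suc s + k. f i * of_real (T i j)) = (\<Sum>j<Suc s. f j)" for s
    by (intro sum.cong refl inv) auto
  then show "\<forall>s. flow (zero_ext f) (int (Suc s)) = 0"
    unfolding cut_zero_ext sum_invariance by simp
next
  assume cut: "\<forall>s. flow (zero_ext f) (int (Suc s)) = 0"
  define R where "R s = (\<Sum>j<Suc s. \<Sum>i<Suc s + k. f i * of_real (T i j))" for s
  have R: "R s = (\<Sum>i<Suc s. f i)" for s
    using cut[rule_format, of s] unfolding cut_zero_ext sum_invariance R_def right_minus_eq .
  have ext: "(\<Sum>i<M. f i * of_real (T i j)) = (\<Sum>i<M'. f i * of_real (T i j))" if "j + k < M" "M \<le> M'" for j M M'
    by (rule sum.mono_neutral_left) (use that in \<open>auto simp: trans_far\<close>)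
  have last: "(\<Sum>i<Suc s + k. f i * of_real (T i s)) = f s" for s
  proof (cases s)
    case 0
    then show ?thesis using R[of 0] by (simp add: R_def)
  next
    case (Suc u)
    have "R (Suc u) = R u + (\<Sum>i<Suc s + k. f i * of_real (T i s))"
    proof -
      have "R (Suc u) = (\<Sum>j<Suc u. \<Sum>i<Suc s + k. f i * of_real (T i j)) + (\<Sum>i<Suc s + k. f i * of_real (T i s))"
        unfolding R_def Suc by simp
      also have "(\<Sum>j<Suc u. \<Sum>i<Suc s + k. f i * of_real (T i j)) = R u"
        unfolding R_def by (intro sum.cong refl ext[symmetric]) (auto simp: Suc)
      finally show ?thesis .
    qed
    then show ?thesis using R[of u] R[of "Suc u"] Suc by simp
  qed
  show "leap_invariant k p q f" unfolding invariant_iff_finite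
  proof (intro allI impI)
    fix j M assume "j + k < M"
    then show "(\<Sum>i<M. f i * of_real (T i j)) = f j"
      using ext[of j "Suc j + k" M] last[of j] by simp
  qed
qed

section \<open>Extreme step sizes and the drift\<close>

lemma kp_props: "np \<in> {1..k}" "0 < p np" "\<And>l. np < l \<Longrightarrow> l \<le> k \<Longrightarrow> p l = 0"
proof -
  let ?A = "{j \<in> {1..k}. 0 < p j}"
  have "?A \<noteq> {}"
  proof
    assume "?A = {}"
    then have "(\<Sum>j=1..k. p j) \<le> 0" by (intro sum_nonpos) force
    then show False using p_pos by simp
  qed
  then have "np \<in> ?A" unfolding kp_def by (intro Max_in) auto
  then show "np \<in> {1..k}" "0 < p np" by auto
  show "p l = 0" if "np < l" "l \<le> k" for l
  proof -
    have "l \<notin> ?A"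
    proof
      assume "l \<in> ?A"
      then have "l \<le> np" unfolding kp_def by (intro Max_ge) auto
      then show False using that(1) by simp
    qed
    moreover have l: "l \<in> {1..k}" using that \<open>np \<in> ?A\<close> by simp
    moreover have "0 \<le> p l" using nonneg l by blast
    ultimately show ?thesis by simp
  qed
qed

lemma kq_props: "nq \<in> {1..k}" "0 < q nq" "\<And>l. nq < l \<Longrightarrow> l \<le> k \<Longrightarrow> q l = 0"
proof -
  let ?A = "{j \<in> {1..k}. 0 < q j}"
  have "?A \<noteq> {}"
  proof
    assume "?A = {}"
    then have "(\<Sum>j=1..k. q j) \<le> 0" by (intro sum_nonpos) force
    then show False using q_pos by simp
  qed
  then have "nq \<in> ?A" unfolding kq_def by (intro Max_in) auto
  then show "nq \<in> {1..k}" "0 < q nq" by auto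
  show "q l = 0" if "nq < l" "l \<le> k" for l
  proof -
    have "l \<notin> ?A"
    proof
      assume "l \<in> ?A"
      then have "l \<le> nq" unfolding kq_def by (intro Max_ge) auto
      then show False using that(1) by simp
    qed
    moreover have l: "l \<in> {1..k}" using that \<open>nq \<in> ?A\<close> by simp
    moreover have "0 \<le> q l" using nonneg l by blast
    ultimately show ?thesis by simp
  qed
qed

text \<open>Tail sums add up to first moments. In terms of the characteristic polynomial this is
  \<psi>(1) = - \<mu>.\<close>

lemma sum_gamma: "(\<Sum>j<2 * k. \<gamma> j) = - leap_mu k p q"
proof -
  have tri: "(\<Sum>t=1..k. \<Sum>l=t..k. f l) = (\<Sum>l=1..k. real l * f l)" for f :: "nat \<Rightarrow> real"
    unfolding sum_triangle_swap by simp
  have "(\<Sum>j<2 * k. \<gamma> j) = (\<Sum>j<k. \<gamma> j) + (\<Sum>j\<in>{k..<2 * k}. \<gamma> j)"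
    unfolding lessThan_atLeast0 by (rule sum.atLeastLessThan_concat[symmetric]) auto
  also have "(\<Sum>j<k. \<gamma> j) = (\<Sum>t=1..k. - (\<Sum>l=t..k. p l))"
    by (rule sum.reindex_bij_witness[of _ "\<lambda>t. k - t" "\<lambda>j. k - j"]) (auto simp: gamma_def)
  also have "\<dots> = - (\<Sum>l=1..k. real l * p l)" unfolding sum_negf tri ..
  also have "(\<Sum>j\<in>{k..<2 * k}. \<gamma> j) = (\<Sum>t=1..k. \<Sum>l=t..k. q l)"
    by (rule sum.reindex_bij_witness[of _ "\<lambda>t. k + t - 1" "\<lambda>j. j - k + 1"]) (auto simp: gamma_def)
  finally show ?thesis
    unfolding tri leap_mu_def by (simp add: right_diff_distrib sum_subtractf)
qed

lemma gamma_nonneg: "k \<le> j \<Longrightarrow> 0 \<le> \<gamma> j"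
  by (simp add: gamma_eq_cdf cdf_nonneg)

lemma gamma_k: "\<gamma> k = (\<Sum>l=1..k. q l)"
  using cdf_neg[of 1] by (simp add: gamma_eq_cdf)

section \<open>Uniqueness of summable invariant vectors\<close>

text \<open>By the triangle inequality \<open>g j\<close> is at most the mass
  \<open>\<tau> j\<close> arriving at \<open>j\<close>; as transitions create no mass, equality must
  hold everywhere.\<close>

lemma invariant_norm:
  fixes f :: "nat \<Rightarrow> 'a::real_normed_field"
  assumes inv: "leap_invariant k p q f" and sm: "summable (\<lambda>i. norm (f i))"
  shows "leap_invariant k p q (\<lambda>i. norm (f i))"
proof -
  define g where "g i = norm (f i)" for i
  define \<tau> where "\<tau> j = (\<Sum>i<Suc j + k. g i * T i j)" for j
  have ext: "(\<Sum>i<M. g i * T i j) = \<tau> j" if "j + k < M" for j M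
    unfolding \<tau>_def by (rule sum.mono_neutral_right) (use that in \<open>auto simp: trans_far\<close>)
  have le: "g j \<le> \<tau> j" for j
  proof -
    have "f j = (\<Sum>i<Suc j + k. f i * of_real (T i j))"
      using inv unfolding invariant_iff_finite by (metis add_less_mono1 lessI)
    then have "g j \<le> (\<Sum>i<Suc j + k. norm (f i * of_real (T i j)))"
      unfolding g_def by (metis norm_sum)
    also have "\<dots> = \<tau> j" unfolding \<tau>_def g_def by (intro sum.cong) (auto simp: norm_mult trans_nonneg)
    finally show ?thesis .
  qed
  have bound: "(\<Sum>j<Suc s. \<tau> j) \<le> (\<Sum>i<Suc s + k. g i)" for s
  proof -
    have "(\<Sum>j<Suc s. \<tau> j) = (\<Sum>j<Suc s. \<Sum>i<Suc s + k. g i * of_real (T i j))"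
      unfolding of_real_eq_id id_def by (intro sum.cong refl ext[symmetric]) auto
    also have "\<dots> = (\<Sum>i<Suc s + k. g i * F (int s - int i))"
      unfolding sum_invariance by simp
    also have "\<dots> \<le> (\<Sum>i<Suc s + k. g i)"
      by (intro sum_mono mult_left_le cdf_le_1) (auto simp: g_def)
    finally show ?thesis .
  qed
  have "\<tau> j \<le> g j" for j
  proof -
    \<comment> \<open>\<open>d s\<close> is the block of the \<open>k\<close> terms of
      \<open>g\<close> after index \<open>s\<close>. It bounds the excess of \<open>\<tau>\<close>
      over \<open>g\<close> accumulated up to \<open>s\<close>, and it tends to 0 by
      summability.\<close>
    define d where "d s = (\<Sum>i<s + (Suc k). g i) - (\<Sum>i<s + Suc 0. g i)" for s
    have "d \<longlonglongrightarrow> suminf g - suminf g" unfolding d_def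
      by (intro tendsto_diff LIMSEQ_ignore_initial_segment summable_LIMSEQ) (use sm in \<open>simp_all add: g_def\<close>)
    then have "d \<longlonglongrightarrow> 0" by simp
    moreover have "\<tau> j - g j \<le> d s" if "s \<ge> j" for s
    proof -
      have "\<tau> j - g j \<le> (\<Sum>j<Suc s. \<tau> j - g j)"
        using that le by (intro member_le_sum) auto
      also have "\<dots> \<le> d s" unfolding d_def sum_subtractf using bound[of s] by simp
      finally show ?thesis .
    qed
    ultimately have "\<tau> j - g j \<le> 0" by (intro LIMSEQ_le_const) auto
    then show ?thesis by simp
  qed
  then have "\<tau> j = g j" for j using le by (simp add: order.antisym)
  then have "leap_invariant k p q g" unfolding invariant_iff_finite using ext by simp
  then show ?thesis by (simp add: g_def[abs_def])
qed

text \<open>Every state \<open>i > 0\<close> reaches a smaller one in one step, by a leap of size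
  \<open>nq\<close> (to 0 if \<open>i \<le> nq\<close>). Since \<open>f i * T i j \<le> f j\<close>,
  zeros propagate upwards from state 0.\<close>

lemma invariant_nonneg_zero:
  fixes f :: "nat \<Rightarrow> real"
  assumes inv: "leap_invariant k p q f" and nn: "\<And>i. 0 \<le> f i" and "f 0 = 0"
  shows "f i = 0"
proof (induction i rule: less_induct)
  case (less i)
  have term_le: "f i * T i j \<le> f j" for j
  proof -
    have "f i * T i j \<le> (\<Sum>i<Suc (i + j + k). f i * T i j)"
      by (rule member_le_sum) (auto simp: nn trans_nonneg)
    also have "\<dots> = f j" using inv unfolding invariant_iff_finite by (simp del: sum.lessThan_Suc)
    finally show ?thesis .
  qed
  show ?case
  proof (cases "i = 0")
    case False
    have "\<exists>j<i. T i j > 0"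
    proof (cases "i \<le> nq")
      case True
      have "q nq \<le> (\<Sum>l\<in>{i..k}. q l)"
        using True False kq_props nonneg by (intro member_le_sum) auto
      then have "T i 0 > 0" using cdf_neg[of i] False kq_props(2) by (simp add: trans_0)
      then show ?thesis using False by blast
    next
      case False
      then have "T i (i - nq) > 0" using kq_props by (auto simp: leap_trans_def xi_prob_def of_nat_diff)
      then show ?thesis using False kq_props(1) by (intro exI[of _ "i - nq"]) auto
    qed
    then obtain j where j: "j < i" "T i j > 0" by auto
    then have "f i * T i j \<le> 0" using less.IH[of j] term_le[of j] by simp
    then show ?thesis using j(2) nn[of i] by (simp add: mult_le_0_iff)
  qed (simp add: assms)
qed

text \<open>Applied to differences, this shows that the value at state 0 determines a summable
  invariant vector.\<close>

lemma invariant_eq_0: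
  fixes f :: "nat \<Rightarrow> 'a::real_normed_field"
  assumes "leap_invariant k p q f" "summable (\<lambda>i. norm (f i))" "f 0 = 0"
  shows "f i = 0"
  using invariant_nonneg_zero[OF invariant_norm[OF assms(1,2)]] assms(3) by simp

section \<open>Stationary distributions, drift and normalization\<close>

lemma stationary_imp_invariant:
  assumes "leap_stationary k p q \<pi>"
  shows "leap_invariant k p q (\<lambda>i. of_real (\<pi> i) :: 'a::{real_normed_field,banach})"
  unfolding leap_invariant_def
proof
  fix j
  have "(\<lambda>i. \<pi> i * T i j) sums \<pi> j" using assms by (simp add: leap_stationary_def)
  from sums_of_real[OF this, where 'a='a]
  show "(\<lambda>i. of_real (\<pi> i) * of_real (T i j)) sums (of_real (\<pi> j) :: 'a)" by simp
qed

lemma stationary_0_pos: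
  assumes "leap_stationary k p q \<pi>"
  shows "0 < \<pi> 0"
proof (rule ccontr)
  assume "\<not> 0 < \<pi> 0"
  then have "\<pi> 0 = 0" using assms by (auto simp: leap_stationary_def intro: order.antisym)
  moreover have "leap_invariant k p q \<pi>" using stationary_imp_invariant[OF assms, where 'a=real] by simp
  moreover have "0 \<le> \<pi> i" for i using assms by (simp add: leap_stationary_def)
  ultimately have "\<pi> i = 0" for i using invariant_nonneg_zero by blast
  then have "\<pi> = (\<lambda>_. 0)" by blast
  then show False using assms sums_unique2[OF sums_zero, of "1::real"] by (auto simp: leap_stationary_def)
qed

text \<open>Summing all cut equations gives 0 as the sum of \<open>\<gamma> j * A j\<close>.
  Replacing the weights \<open>A j\<close> by 1 strictly increases this sum, because
  \<open>A k = 1 - \<pi> 0 < 1\<close> and \<open>\<gamma> k > 0\<close>, and the result is -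
  \<mu>.\<close>

lemma stationary_imp_mu_neg:
  assumes st: "leap_stationary k p q \<pi>"
  shows "leap_mu k p q < 0"
proof -
  have s1: "\<pi> sums 1" and nn: "\<And>i. 0 \<le> \<pi> i" using st by (auto simp: leap_stationary_def)
  \<comment> \<open>The mass met by the \<open>j\<close>-th coefficient as the cut runs through all
    positions. For \<open>j < k\<close> the truncated subtraction gives an empty sum, so
    \<open>A j = 1\<close>.\<close>
  define A where "A j = 1 - (\<Sum>i<Suc j - k. \<pi> i)" for j
  have A: "(\<lambda>s. zero_ext \<pi> (int (Suc s) - int k + int j)) sums A j" for j
  proof (cases "j < k")
    case True
    have "(\<lambda>s. zero_ext \<pi> (int (Suc (s + (k - 1 - j))) - int k + int j)) = \<pi>"
      using True by (auto simp: zero_ext_def fun_eq_iff of_nat_diff)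
    then have "(\<lambda>s. zero_ext \<pi> (int (Suc (s + (k - 1 - j))) - int k + int j)) sums 1" using s1 by simp
    then have "(\<lambda>s. zero_ext \<pi> (int (Suc s) - int k + int j)) sums 1"
      by (subst (asm) sums_zero_iff_shift) (use True in \<open>auto simp: zero_ext_def\<close>)
    then show ?thesis using True by (simp add: A_def)
  next
    case False
    have "(\<lambda>s. zero_ext \<pi> (int (Suc s) - int k + int j)) = (\<lambda>s. \<pi> (s + (Suc j - k)))"
    proof
      fix s
      have eq: "int (Suc s) - int k + int j = int (s + (Suc j - k))" using False by (simp add: of_nat_diff)
      show "zero_ext \<pi> (int (Suc s) - int k + int j) = \<pi> (s + (Suc j - k))"
        unfolding eq zero_ext_def nat_int by simp
    qed
    then show ?thesis using sums_split_initial_segment[OF s1, of "Suc j - k"] by (simp add: A_def)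
  qed
  have "leap_invariant k p q \<pi>" using stationary_imp_invariant[OF st, where 'a=real] by simp
  then have "flow (zero_ext \<pi>) (int (Suc s)) = 0" for s by (simp add: invariant_iff_cut)
  moreover have "(\<lambda>s. flow (zero_ext \<pi>) (int (Suc s))) sums (\<Sum>j<2 * k. of_real (\<gamma> j) * A j)"
    unfolding cut_flow_def by (intro sums_sum sums_mult A)
  ultimately have "(\<lambda>s. 0) sums (\<Sum>j<2 * k. \<gamma> j * A j)" by simp
  then have "(\<Sum>j<2 * k. \<gamma> j * A j) = 0" using sums_unique2 sums_zero by blast
  moreover have "(\<Sum>j<2 * k. \<gamma> j * A j) < (\<Sum>j<2 * k. \<gamma> j)"
  proof (rule sum_strict_mono_ex1)
    have le1: "A j \<le> 1" for j by (simp add: A_def sum_nonneg nn)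
    \<comment> \<open>Coefficients with \<open>j < k\<close> may be negative, but there
      \<open>A j = 1\<close>.\<close>
    show "\<forall>j\<in>{..<2 * k}. \<gamma> j * A j \<le> \<gamma> j"
    proof
      fix j
      show "\<gamma> j * A j \<le> \<gamma> j"
        using mult_left_le[OF le1 gamma_nonneg] by (cases "j < k") (auto simp: A_def)
    qed
    have "A k < 1" using stationary_0_pos[OF st] by (simp add: A_def)
    then have "\<gamma> k * A k < \<gamma> k * 1" using q_pos by (intro mult_strict_left_mono) (auto simp: gamma_k)
    then show "\<exists>j\<in>{..<2 * k}. \<gamma> j * A j < \<gamma> j" using k_pos by (intro bexI[of _ k]) auto
  qed simp
  ultimately show ?thesis by (simp add: sum_gamma)
qed

lemma invariant_normalizes:
  fixes f :: "nat \<Rightarrow> complex"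
  assumes inv: "leap_invariant k p q f" and sm: "summable (\<lambda>i. norm (f i))" and f0: "f 0 \<noteq> 0"
  shows "suminf f \<noteq> 0"
    and "\<exists>\<pi>. leap_stationary k p q \<pi>"
    and "leap_stationary k p q \<pi> \<Longrightarrow> complex_of_real (\<pi> i) = f i / suminf f"
proof -
  have *: "suminf f \<noteq> 0 \<and> complex_of_real (\<pi> i) = f i / suminf f" if st: "leap_stationary k p q \<pi>" for \<pi> i
  proof -
    \<comment> \<open>Chosen so that \<open>f - c * \<pi>\<close> vanishes at state 0.\<close>
    define c where "c = f 0 / of_real (\<pi> 0)"
    have \<pi>0: "\<pi> 0 \<noteq> 0" using stationary_0_pos[OF st] by simp
    have s1: "\<pi> sums 1" and nn: "\<And>i. 0 \<le> \<pi> i" using st by (auto simp: leap_stationary_def)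
    have "leap_invariant k p q (\<lambda>i. f i - c * of_real (\<pi> i))"
      using inv stationary_imp_invariant[OF st, where 'a=complex] unfolding leap_invariant_def
      by (auto simp: left_diff_distrib mult.assoc intro!: sums_diff sums_mult)
    moreover have "summable (\<lambda>i. norm (f i - c * of_real (\<pi> i)))"
    proof (rule summable_comparison_test')
      show "summable (\<lambda>i. norm (f i) + norm c * \<pi> i)"
        using sm s1 by (intro summable_add summable_mult) (auto simp: sums_iff)
      show "norm (norm (f i - c * of_real (\<pi> i))) \<le> norm (f i) + norm c * \<pi> i" for i
        using norm_triangle_ineq4[of "f i" "c * of_real (\<pi> i)"] nn[of i] by (simp add: norm_mult)
    qed
    moreover have "f 0 - c * of_real (\<pi> 0) = 0" using \<pi>0 by (simp add: c_def)
    ultimately have "f i - c * of_real (\<pi> i) = 0" for i by (rule invariant_eq_0)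
    then have f: "f = (\<lambda>i. c * of_real (\<pi> i))" by auto
    have "f sums (c * of_real 1)" unfolding f by (intro sums_mult sums_of_real s1)
    then have "suminf f = c" by (simp add: sums_iff)
    moreover have "c \<noteq> 0" using f0 \<pi>0 by (simp add: c_def)
    ultimately show ?thesis by (simp add: f)
  qed
  \<comment> \<open>Existence: the normalized norms of \<open>f\<close> form a stationary
    distribution, and only then does \<open>*\<close> yield that the sum of \<open>f\<close> is
    nonzero.\<close>
  define N where "N = (\<Sum>i. norm (f i))"
  have N: "N > 0" unfolding N_def using f0 sm by (intro suminf_pos2[of _ 0]) auto
  have ninv: "(\<lambda>i. norm (f i) * T i j) sums norm (f j)" for j
    using invariant_norm[OF inv sm] unfolding leap_invariant_def by simp
  have "leap_stationary k p q (\<lambda>i. norm (f i) / N)"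
    unfolding leap_stationary_def
  proof (intro conjI allI)
    show "(\<lambda>i. norm (f i) / N) sums 1"
      using sums_divide[OF summable_sums[OF sm], of N] N by (simp add: N_def)
    show "(\<lambda>i. norm (f i) / N * T i j) sums (norm (f j) / N)" for j
      using sums_divide[OF ninv[of j], of N] by (simp add: field_simps)
  qed (use N in simp)
  then show "\<exists>\<pi>. leap_stationary k p q \<pi>" "suminf f \<noteq> 0" using * by blast+
  show "leap_stationary k p q \<pi> \<Longrightarrow> complex_of_real (\<pi> i) = f i / suminf f" using * by blast
qed

subsection \<open>Decaying solutions of the cut equations\<close>

abbreviation "\<psi> \<equiv> psi_poly k p q"

lemma coeff_psi: "coeff \<psi> j = complex_of_real (\<gamma> j)"
  by (auto simp: psi_poly_def coeff_Poly_eq nth_default_def gamma_def)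

lemma psi_nonzero: "\<psi> \<noteq> 0"
proof -
  have "\<gamma> k \<noteq> 0" using gamma_k q_pos by simp
  then have "coeff \<psi> k \<noteq> 0" by (simp add: coeff_psi)
  then show ?thesis by auto
qed

lemma degree_psi: "degree \<psi> < 2 * k"
proof -
  have "coeff \<psi> j = 0" if "j \<ge> 2 * k" for j using that by (simp add: coeff_psi gamma_def)
  then have "degree \<psi> \<le> 2 * k - 1" by (intro degree_le) auto
  then show ?thesis using k_pos by linarith
qed

lemma poly_psi_of_real: "poly \<psi> (of_real x) = complex_of_real (\<Sum>j<2 * k. \<gamma> j * x ^ j)"
proof -
  have "poly \<psi> (of_real x) = (\<Sum>j<2 * k. coeff \<psi> j * of_real x ^ j)"
    unfolding poly_altdef by (rule sum.mono_neutral_left) (use degree_psi in \<open>auto simp: coeff_eq_0\<close>)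
  then show ?thesis by (simp add: coeff_psi)
qed

lemma gamma_zero: "j + np < k \<Longrightarrow> \<gamma> j = 0"
  using kp_props(3) by (auto simp: gamma_def intro!: sum.neutral)

text \<open>The coefficient of index \<open>k - np\<close> is at most \<open>- p np\<close>, hence
  nonzero.\<close>

lemma order_0_psi: "order 0 \<psi> \<le> k - np"
proof (rule ccontr)
  assume "\<not> order 0 \<psi> \<le> k - np"
  then have "monom 1 (Suc (k - np)) dvd \<psi>"
    using psi_nonzero by (simp add: monom_1_dvd_iff)
  then have "coeff \<psi> (k - np) = 0" by (simp only: monom_1_dvd_iff')
  then have "\<gamma> (k - np) = 0" by (simp add: coeff_psi)
  moreover have "p np \<le> (\<Sum>l\<in>{np..k}. p l)"
    using kp_props nonneg by (intro member_le_sum) auto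
  ultimately show False using kp_props by (auto simp: gamma_def)
qed

text \<open>The left-hand side is the \<open>j\<close>-th coefficient of (1 - z) \<psi>(z), which is
  therefore z^k - E z^(k - \<xi>).\<close>

lemma gamma_step: "\<gamma> j - (if j = 0 then 0 else \<gamma> (j - 1)) = (if j = k then 1 else 0) - xi (int k - int j)"
proof (cases j)
  case 0
  then show ?thesis using cdf_step[of "int k - 1"] cdf_high[of "int k"] k_pos
    by (simp add: gamma_eq_cdf)
next
  case (Suc i)
  then show ?thesis using cdf_step[of "int k - int j - 1"] by (auto simp: gamma_eq_cdf algebra_simps)
qed

text \<open>As \<psi>(1) = - \<mu> > 0, \<psi> is positive just left of 1, which gives E \<rho>^(k -
  \<xi>) < \<rho>^k. Rouche then finds \<open>k\<close> roots of \<open>G\<close> in the disc, of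
  which at most \<open>k - np\<close> lie at 0.\<close>

lemma psi_roots_in_disc:
  assumes mu: "leap_mu k p q < 0"
  obtains \<rho> where "0 < \<rho>" "\<rho> < 1" "np \<le> (\<Sum>z | cmod z < \<rho> \<and> z \<noteq> 0 \<and> poly \<psi> z = 0. order z \<psi>)"
proof -
  define h where "h x = (\<Sum>j<2 * k. \<gamma> j * x ^ j)" for x :: real
  have "isCont h 1" unfolding h_def by (intro continuous_intros)
  moreover have "h 1 > 0" using sum_gamma mu by (simp add: h_def)
  ultimately have "eventually (\<lambda>x. h x > 0) (at 1)"
    unfolding isCont_def by (auto dest: order_tendstoD(1))
  then have "eventually (\<lambda>x. h x > 0) (at_left 1)" by (rule filter_leD[OF at_le, rotated]) auto
  then obtain b where b: "b < 1" "\<And>y. b < y \<Longrightarrow> y < 1 \<Longrightarrow> h y > 0"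
    using eventually_at_left[of "0::real" 1 "\<lambda>x. h x > 0"] by auto
  \<comment> \<open>The midpoint of \<open>max b 0\<close> and 1, which stays positive even if
    \<open>b\<close> is negative.\<close>
  define \<rho> where "\<rho> = (max b 0 + 1) / 2"
  have \<rho>: "0 < \<rho>" "\<rho> < 1" "h \<rho> > 0" using b(1) by (auto simp: \<rho>_def intro!: b(2))
  define f :: "complex poly" where "f = monom 1 k"
  define G where "G = [:1, -1:] * \<psi>"
  define g where "g = G - f"
  have cG: "coeff G j = of_real (\<gamma> j - (if j = 0 then 0 else \<gamma> (j - 1)))" for j
    by (cases j) (auto simp: G_def coeff_psi coeff_pCons)
  have cg: "coeff g j = - of_real (xi (int k - int j))" for j
    unfolding g_def f_def coeff_diff cG gamma_step by auto
  have pg: "poly g z = - (\<Sum>j\<le>2 * k. of_real (xi (int k - int j)) * z ^ j)" for z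
  proof -
    have "degree g \<le> 2 * k" by (rule degree_le) (auto simp: cg xi_outside)
    then have "poly g z = (\<Sum>j\<le>2 * k. coeff g j * z ^ j)"
      unfolding poly_altdef by (intro sum.mono_neutral_left) (auto simp: coeff_eq_0)
    then show ?thesis by (simp add: cg sum_negf)
  qed
  have less: "cmod (poly g z) < cmod (poly f z)" if "cmod z = \<rho>" for z
  proof -
    have "cmod (poly g z) \<le> (\<Sum>j\<le>2 * k. cmod (of_real (xi (int k - int j)) * z ^ j))"
      unfolding pg norm_minus_cancel by (rule norm_sum)
    also have "\<dots> = (\<Sum>j\<le>2 * k. xi (int k - int j) * \<rho> ^ j)"
      by (simp add: norm_mult norm_power that xi_nonneg)
    \<comment> \<open>The coefficients of \<open>- g\<close> are nonnegative, so the bound is the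
      value of \<open>- g\<close> at the positive real point \<open>\<rho>\<close>.\<close>
    also have "\<dots> = \<rho> ^ k - (1 - \<rho>) * h \<rho>"
    proof -
      have "complex_of_real (\<Sum>j\<le>2 * k. xi (int k - int j) * \<rho> ^ j) = - poly g (of_real \<rho>)"
        by (simp add: pg)
      also have "\<dots> = of_real (\<rho> ^ k - (1 - \<rho>) * h \<rho>)"
        by (simp add: g_def f_def G_def poly_psi_of_real h_def poly_monom algebra_simps)
      finally show ?thesis by (simp only: of_real_eq_iff)
    qed
    also have "\<dots> < \<rho> ^ k" using \<rho> by simp
    also have "\<dots> = cmod (poly f z)" by (simp add: f_def poly_monom norm_power that)
    finally show ?thesis .
  qed
  have "(\<Sum>z | cmod z < \<rho> \<and> poly G z = 0. order z G) = (\<Sum>z | cmod z < \<rho> \<and> poly f z = 0. order z f)"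
    using Rouche_poly_disc[OF \<rho>(1) less] by (simp add: g_def)
  also have "{z. cmod z < \<rho> \<and> poly f z = 0} = {0}" using \<rho> k_pos by (auto simp: f_def poly_monom)
  also have "(\<Sum>z\<in>{0}. order z f) = k" by (simp add: f_def order_0_monom)
  finally have k: "(\<Sum>z | cmod z < \<rho> \<and> poly G z = 0. order z G) = k" .
  have G0: "G \<noteq> 0" unfolding G_def mult_eq_0_iff using psi_nonzero by simp
  have ord: "order z G = order z \<psi>" and root: "poly G z = 0 \<longleftrightarrow> poly \<psi> z = 0" if "cmod z < \<rho>" for z
  proof -
    \<comment> \<open>The extra factor 1 - z of \<open>G\<close> has its root outside the disc, so
      it changes no order there.\<close>
    have z: "z \<noteq> 1" using that \<rho> by auto
    then have "order z [:1, - 1:] = 0" by (simp add: order_0I)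
    then show "order z G = order z \<psi>" using G0 unfolding G_def by (subst order_mult) auto
    show "poly G z = 0 \<longleftrightarrow> poly \<psi> z = 0" using z by (simp add: G_def)
  qed
  let ?Z = "{z. cmod z < \<rho> \<and> poly \<psi> z = 0}" and ?Z' = "{z. cmod z < \<rho> \<and> z \<noteq> 0 \<and> poly \<psi> z = 0}"
  have fin: "finite ?Z'" by (rule finite_subset[OF _ poly_roots_finite[OF psi_nonzero]]) auto
  have "(\<Sum>z | cmod z < \<rho> \<and> poly G z = 0. order z G) = (\<Sum>z\<in>?Z. order z \<psi>)"
    by (rule sum.cong) (auto simp: ord root)
  with k have "k = (\<Sum>z\<in>?Z. order z \<psi>)" by simp
  also have "\<dots> \<le> (\<Sum>z\<in>insert 0 ?Z'. order z \<psi>)"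
    using fin by (intro sum_mono2) auto
  also have "\<dots> = order 0 \<psi> + (\<Sum>z\<in>?Z'. order z \<psi>)" using fin by simp
  finally have "np \<le> (\<Sum>z\<in>?Z'. order z \<psi>)" using order_0_psi kp_props(1) by auto
  then show ?thesis using that \<rho> by blast
qed

section \<open>From increments to summable invariant vectors\<close>

text \<open>The hypothesis is the first cut equation after summation by parts: for
  \<open>j = e + np - 1\<close>, \<open>eta\<close> is the sum of \<open>(l + 1 - e) * q l\<close>
  over \<open>l\<close> from \<open>e\<close> to \<open>nq\<close>, the coefficient of the increment
  \<open>w e\<close>.\<close>

lemma boundary_equation:
  fixes w :: "int \<Rightarrow> complex" and \<sigma>0 :: complex
  defines "\<sigma> \<equiv> \<lambda>i::nat. \<sigma>0 + (\<Sum>e=1..i. w (int e))"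
  assumes "(\<Sum>j=np..leap_r k p q. of_real (eta k p q j) * w (int j + 1 - int np))
      = \<sigma>0 * of_real ((\<Sum>l=1..np. p l) - (\<Sum>l=1..nq. real l * q l))"
  shows "flow (zero_ext \<sigma>) 1 = 0"
proof -
  have np: "1 \<le> np" "np \<le> k" and nq: "1 \<le> nq" "nq \<le> k" using kp_props(1) kq_props(1) by auto
  have psum: "(\<Sum>l=1..k. p l) = (\<Sum>l=1..np. p l)"
    by (rule sum.mono_neutral_right) (use np kp_props(3) in auto)
  have qsum: "(\<Sum>l=1..k. g l * of_real (q l)) = (\<Sum>l=1..nq. g l * of_real (q l))" for g :: "nat \<Rightarrow> complex"
    by (rule sum.mono_neutral_right) (use nq kq_props(3) in auto)
  have "(\<Sum>j=np..leap_r k p q. of_real (eta k p q j) * w (int j + 1 - int np))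
     = (\<Sum>e=1..nq. \<Sum>l=e..nq. of_nat (l + 1 - e) * of_real (q l) * w (int e))"
  proof (rule sum.reindex_bij_witness[of _ "\<lambda>e. e + np - 1" "\<lambda>j. j + 1 - np"])
    fix j assume j: "j \<in> {np..leap_r k p q}"
    then show "j + 1 - np \<in> {1..nq}" using np nq by (auto simp: leap_r_def)
    show "j + 1 - np + np - 1 = j" using j by simp
    have "eta k p q j = (\<Sum>l=j + 1 - np..nq. real (l + 1 - (j + 1 - np)) * q l)"
      using j unfolding eta_def by (auto intro!: sum.cong)
    moreover have "int (j + 1 - np) = int j + 1 - int np" using j by (simp add: of_nat_diff)
    ultimately show "(\<Sum>l=j + 1 - np..nq. of_nat (l + 1 - (j + 1 - np)) * of_real (q l) * w (int (j + 1 - np)))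
        = of_real (eta k p q j) * w (int j + 1 - int np)"
      by (simp only: of_real_sum of_real_mult of_real_of_nat_eq sum_distrib_right)
  next
    fix e assume e: "e \<in> {1..nq}"
    show "e + np - 1 + 1 - np = e" using e by simp
    show "e + np - 1 \<in> {np..leap_r k p q}" using e np by (auto simp: leap_r_def)
  qed
  also have "\<dots> = (\<Sum>l=1..nq. (\<Sum>e=1..l. of_nat (l + 1 - e) * w (int e)) * of_real (q l))"
    unfolding sum_triangle_swap sum_distrib_right by (intro sum.cong refl) (simp add: mult_ac)
  finally have eta: "(\<Sum>l=1..nq. (\<Sum>e=1..l. of_nat (l + 1 - e) * w (int e)) * of_real (q l))
      = \<sigma>0 * of_real ((\<Sum>l=1..np. p l) - (\<Sum>l=1..nq. real l * q l))"
    using assms(2) by simp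
  \<comment> \<open>The increment \<open>w e\<close> enters \<open>\<sigma> i\<close> for all
    \<open>i\<close> from \<open>e\<close> to \<open>l\<close>, that is \<open>l + 1 - e\<close>
    times.\<close>
  have partial: "(\<Sum>i=1..l. \<sigma> i) = of_nat l * \<sigma>0 + (\<Sum>e=1..l. of_nat (l + 1 - e) * w (int e))" for l
  proof -
    have "(\<Sum>i=1..l. \<Sum>e=1..i. w (int e)) = (\<Sum>e=1..l. \<Sum>i=e..l. w (int e))"
      by (rule sum_triangle_swap[symmetric])
    then show ?thesis by (simp add: \<sigma>_def sum.distrib)
  qed
  have "(\<Sum>i=1..k. \<sigma> i * of_real (F (- int i))) = (\<Sum>i=1..k. \<Sum>l=i..k. \<sigma> i * of_real (q l))"
    by (intro sum.cong refl) (simp add: cdf_neg sum_distrib_left)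
  also have "\<dots> = (\<Sum>l=1..k. (\<Sum>i=1..l. \<sigma> i) * of_real (q l))"
    unfolding sum_triangle_swap sum_distrib_right ..
  also have "\<dots> = (\<Sum>l=1..nq. (\<Sum>i=1..l. \<sigma> i) * of_real (q l))" by (rule qsum)
  also have "\<dots> = \<sigma>0 * of_real (\<Sum>l=1..nq. real l * q l)
      + (\<Sum>l=1..nq. (\<Sum>e=1..l. of_nat (l + 1 - e) * w (int e)) * of_real (q l))"
    unfolding partial distrib_right sum.distrib by (simp add: sum_distrib_left mult_ac)
  also have "\<dots> = \<sigma>0 * of_real (\<Sum>l=1..k. p l)" unfolding eta psum by (simp add: algebra_simps)
  finally have cut: "(\<Sum>i=1..k. \<sigma> i * of_real (F (- int i))) = \<sigma>0 * of_real (\<Sum>l=1..k. p l)" .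
  have "flow (zero_ext \<sigma>) 1 = (\<Sum>i<Suc k. \<sigma> i * of_real (F (- int i))) - \<sigma> 0"
    using cut_zero_ext[of \<sigma> 0] by simp
  also have "{..<Suc k} = insert 0 {1..k}" by auto
  also have "(\<Sum>i\<in>insert 0 {1..k}. \<sigma> i * of_real (F (- int i))) = \<sigma>0 * of_real (F 0) + \<sigma>0 * of_real (\<Sum>l=1..k. p l)"
  proof -
    have "(\<Sum>i\<in>insert 0 {1..k}. \<sigma> i * of_real (F (- int i)))
        = \<sigma> 0 * of_real (F 0) + (\<Sum>i=1..k. \<sigma> i * of_real (F (- int i)))" by simp
    then show ?thesis unfolding cut by (simp add: \<sigma>_def)
  qed
  also have "\<dots> - \<sigma> 0 = \<sigma>0 * of_real (F 0 + (\<Sum>l=1..k. p l) - 1)"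
    by (simp add: \<sigma>_def algebra_simps)
  also have "\<dots> = 0" using total_split by (simp add: cdf_0)
  finally show ?thesis .
qed

text \<open>From \<open>2 - np\<close> on, \<open>w\<close> is the increment of the zero extension
  of \<sigma>, with the jump \<open>\<sigma>0\<close> at 0. Hence the flow is constant over the cuts
  1, 2, ..., and \<open>boundary_equation\<close> makes it 0 at the first.\<close>

lemma difference_invariant:
  fixes w :: "int \<Rightarrow> complex" and \<sigma>0 :: complex
  defines "\<sigma> \<equiv> \<lambda>i::nat. \<sigma>0 + (\<Sum>e=1..i. w (int e))"
  assumes flow_w: "\<And>i. flow w i = 0"
    and w_neg: "\<And>e. 2 - int np \<le> e \<Longrightarrow> e < 0 \<Longrightarrow> w e = 0"
    and w_0: "2 \<le> np \<Longrightarrow> w 0 = \<sigma>0"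
    and bottom: "(\<Sum>j=np..leap_r k p q. of_real (eta k p q j) * w (int j + 1 - int np))
      = \<sigma>0 * of_real ((\<Sum>l=1..np. p l) - (\<Sum>l=1..nq. real l * q l))"
  shows "leap_invariant k p q \<sigma>"
proof -
  define S where "S = zero_ext \<sigma>"
  have w: "S e - S (e - 1) = w e" if e: "2 - int np \<le> e" for e
  proof -
    consider "e < 0" | "e = 0" | j where "e = int (Suc j)"
      by (metis linorder_neqE_linordered_idom nonneg_int_cases not_le zero_less_imp_eq_int gr0_implies_Suc of_nat_0_less_iff)
    then show ?thesis
    proof cases
      case 1 then show ?thesis using e w_neg by (simp add: S_def zero_ext_def)
    next
      case 2 then show ?thesis using e w_0 by (simp add: S_def zero_ext_def \<sigma>_def)
    next
      case 3
      then have "S e = \<sigma> (Suc j)" "S (e - 1) = \<sigma> j" by (auto simp: S_def zero_ext_def nat_add_distrib)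
      then show ?thesis using 3 by (simp add: \<sigma>_def)
    qed
  qed
  have step: "flow S (int (Suc (Suc s))) = flow S (int (Suc s))" for s
  proof -
    let ?i = "int (Suc (Suc s))"
    have "flow S ?i - flow S (int (Suc s)) = (\<Sum>j<2 * k. of_real (\<gamma> j) * (S (?i - int k + int j) - S (?i - int k + int j - 1)))"
      unfolding cut_flow_def sum_subtractf[symmetric] by (intro sum.cong refl) (simp add: algebra_simps)
    also have "\<dots> = (\<Sum>j<2 * k. of_real (\<gamma> j) * w (?i - int k + int j))"
    proof (intro sum.cong refl)
      fix j
      show "of_real (\<gamma> j) * (S (?i - int k + int j) - S (?i - int k + int j - 1)) = of_real (\<gamma> j) * w (?i - int k + int j)"
      \<comment> \<open>Coefficients with \<open>j + np < k\<close> vanish; the others only reach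
        indices of at least \<open>2 - np\<close>, where \<open>w\<close> is known to be the
        increment.\<close>
      proof (cases "j + np < k")
        case False
        then show ?thesis by (subst w) auto
      qed (simp add: gamma_zero)
    qed
    also have "\<dots> = 0" using flow_w[of ?i] by (simp add: cut_flow_def)
    finally show ?thesis by simp
  qed
  have "flow S (int (Suc s)) = 0" for s
  proof (induction s)
    case 0
    then show ?case using boundary_equation[OF bottom] by (simp add: S_def \<sigma>_def)
  next
    case (Suc s) then show ?case using step by simp
  qed
  then show ?thesis by (simp add: invariant_iff_cut S_def)
qed

text \<open>In the limit the cut equations read \<psi>(1) L = 0, with \<psi>(1) = - \<mu>.\<close>

lemma invariant_limit_0:
  fixes \<sigma> :: "nat \<Rightarrow> complex"
  assumes "leap_invariant k p q \<sigma>" "\<sigma> \<longlonglongrightarrow> L" "leap_mu k p q \<noteq> 0"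
  shows "L = 0"
proof -
  have "(\<lambda>s. zero_ext \<sigma> (int (Suc s) - int k + int j)) \<longlonglongrightarrow> L" for j
  proof (rule LIMSEQ_offset[of _ k])
    have "zero_ext \<sigma> (int (Suc (s + k)) - int k + int j) = \<sigma> (s + Suc j)" for s
      by (simp add: zero_ext_def nat_add_distrib add.commute)
    then show "(\<lambda>s. zero_ext \<sigma> (int (Suc (s + k)) - int k + int j)) \<longlonglongrightarrow> L"
      using LIMSEQ_ignore_initial_segment[OF assms(2), of "Suc j"] by simp
  qed
  then have "(\<lambda>s. flow (zero_ext \<sigma>) (int (Suc s))) \<longlonglongrightarrow> (\<Sum>j<2 * k. of_real (\<gamma> j) * L)"
    unfolding cut_flow_def by (intro tendsto_intros)
  moreover have "(\<lambda>s. flow (zero_ext \<sigma>) (int (Suc s))) = (\<lambda>s. 0)"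
    using assms(1) by (simp only: invariant_iff_cut)
  ultimately have "(\<Sum>j<2 * k. of_real (\<gamma> j) * L) = 0" by (simp add: LIMSEQ_const_iff)
  then have "of_real (\<Sum>j<2 * k. \<gamma> j) * L = 0" by (simp add: sum_distrib_right)
  then show ?thesis using assms(3) unfolding sum_gamma by simp
qed

text \<open>Geometric increments make \<sigma> converge, necessarily to 0. So \<sigma> is minus the
  tail of its increments, which again decays geometrically.\<close>

lemma difference_summable:
  fixes w :: "int \<Rightarrow> complex" and \<sigma>0 :: complex
  defines "\<sigma> \<equiv> \<lambda>i::nat. \<sigma>0 + (\<Sum>e=1..i. w (int e))"
  assumes inv: "leap_invariant k p q \<sigma>" and mu: "leap_mu k p q \<noteq> 0"
    and \<rho>: "0 < \<rho>" "\<rho> < 1" and bound: "\<And>e::nat. cmod (w (int e)) \<le> K * \<rho> ^ e"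
  shows "summable (\<lambda>i. cmod (\<sigma> i))"
proof -
  define v where "v e = w (int (Suc e))" for e
  have \<sigma>: "\<sigma> i = \<sigma>0 + (\<Sum>e<i. v e)" for i
    unfolding \<sigma>_def v_def
    by (intro arg_cong2[of _ _ _ _ "(+)"] refl sum.reindex_bij_witness[of _ Suc "\<lambda>e. e - 1"]) auto
  have bv: "cmod (v e) \<le> (K * \<rho>) * \<rho> ^ e" for e using bound[of "Suc e"] by (simp add: v_def mult_ac)
  have geo: "summable (\<lambda>e. C * \<rho> ^ e)" for C using \<rho> by (intro summable_mult summable_geometric) auto
  have nv: "summable (\<lambda>e. cmod (v e))"
    by (rule summable_comparison_test'[OF geo[of "K * \<rho>"], of 0]) (use bv in auto)
  then have sv: "summable v" by (rule summable_norm_cancel)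
  have "\<sigma> \<longlonglongrightarrow> \<sigma>0 + suminf v"
    unfolding \<sigma> by (intro tendsto_intros summable_LIMSEQ sv)
  then have "\<sigma>0 + suminf v = 0" using invariant_limit_0 inv mu by blast
  then have tail: "\<sigma> i = - (\<Sum>e. v (e + i))" for i
    unfolding \<sigma> using suminf_split_initial_segment[OF sv, of i] by (simp add: algebra_simps eq_neg_iff_add_eq_0)
  have "cmod (\<sigma> i) \<le> (K * \<rho> / (1 - \<rho>)) * \<rho> ^ i" for i
  proof -
    have "cmod (\<sigma> i) \<le> (\<Sum>e. cmod (v (e + i)))"
      unfolding tail norm_minus_cancel by (intro summable_norm summable_ignore_initial_segment nv)
    also have "\<dots> \<le> (\<Sum>e. (K * \<rho> * \<rho> ^ i) * \<rho> ^ e)"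
    proof (intro suminf_le summable_ignore_initial_segment nv geo)
      show "cmod (v (e + i)) \<le> (K * \<rho> * \<rho> ^ i) * \<rho> ^ e" for e
        using bv[of "e + i"] by (simp add: power_add mult_ac)
    qed
    also have "\<dots> = (K * \<rho> / (1 - \<rho>)) * \<rho> ^ i"
      using \<rho> by (subst suminf_mult) (auto simp: suminf_geometric summable_geometric)
    finally show ?thesis .
  qed
  then show ?thesis by (intro summable_comparison_test'[OF geo[of "K * \<rho> / (1 - \<rho>)"], of 0]) auto
qed

end

subsection \<open>The determinants as an invariant vector\<close>

locale random_leap_roots = random_leap +
  fixes ys :: "complex list"
  assumes ys_distinct: "distinct ys"
    and ys_set: "set ys = {z. z \<noteq> 0 \<and> poly (psi_poly k p q) z = 0}"
    and ys_sorted: "sorted_wrt (\<lambda>a b. cmod a \<le> cmod b) ys"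
    and mu_neg: "leap_mu k p q < 0"
begin

section \<open>The columns of \<Psi>\<close>

abbreviation "colpairs \<equiv> root_cols \<psi> ys"

text \<open>Column \<open>c\<close> of \<Psi> continued to all integers. Row \<open>i\<close> of
  \<Psi> sits at \<open>e = i + 1 - np\<close>, so rows \<open>1..np - 1\<close> are the positions
  from \<open>2 - np\<close> to 0.\<close>

definition col_val :: "nat \<Rightarrow> int \<Rightarrow> complex" where
  "col_val c e = of_int e ^ snd (colpairs ! c) * fst (colpairs ! c) powi e"

lemma Psi_entry_eq: "Psi_entry k p q ys i c = col_val c (int i + 1 - int np)"
  by (simp add: Psi_entry_def col_val_def case_prod_beta Let_def)

lemma decaying_columns:
  obtains \<rho> where "0 < \<rho>" "\<rho> < 1" "np \<le> length colpairs" "\<And>c. c < np \<Longrightarrow> cmod (fst (colpairs ! c)) < \<rho>"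
proof -
  obtain \<rho> where \<rho>: "0 < \<rho>" "\<rho> < 1" "np \<le> (\<Sum>z | cmod z < \<rho> \<and> z \<noteq> 0 \<and> poly \<psi> z = 0. order z \<psi>)"
    using psi_roots_in_disc[OF mu_neg] by blast
  have "{z. cmod z < \<rho> \<and> z \<noteq> 0 \<and> poly \<psi> z = 0} = {z. z \<in> set ys \<and> cmod z < \<rho>}" using ys_set by auto
  then have len: "np \<le> length (filter (\<lambda>c. cmod (fst c) < \<rho>) colpairs)"
    using \<rho>(3) length_filter_root_cols[OF ys_distinct, of "\<lambda>z. cmod z < \<rho>" \<psi>] by simp
  moreover have "np \<le> length colpairs" using len length_filter_le order_trans by blast
  ultimately show ?thesis
    using that[OF \<rho>(1,2)] sorted_wrt_prefix_less(2)[OF sorted_root_cols[OF ys_sorted], of np \<rho> \<psi>] by blast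
qed

lemma col_props:
  assumes "c < length colpairs"
  shows "fst (colpairs ! c) \<noteq> 0" "snd (colpairs ! c) < order (fst (colpairs ! c)) \<psi>"
  using fst_snd_root_cols[of "fst (colpairs ! c)" "snd (colpairs ! c)" \<psi> ys] assms ys_set by auto

lemma flow_col_val:
  assumes "c < length colpairs"
  shows "flow (col_val c) i = 0"
proof -
  obtain y l where yl: "colpairs ! c = (y, l)" by (cases "colpairs ! c")
  have y: "y \<noteq> 0" "l < order y \<psi>" using col_props[OF assms] yl by auto
  \<comment> \<open>The window of the cut at \<open>i\<close> starts at position
    \<open>i - k\<close>.\<close>
  define a :: complex where "a = of_int (i - int k)"
  have "[:- y, 1:] ^ Suc l dvd \<psi>"
    using y(2) order_1[of y \<psi>] by (meson Suc_leI dvd_trans le_imp_power_dvd)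
  then have "(\<Sum>j<2 * k. coeff \<psi> j * ((of_nat j + a) ^ l * y ^ j)) = 0"
    using degree_psi by (rule multiple_root_recurrence)
  then have "0 = y powi (i - int k) * (\<Sum>j<2 * k. coeff \<psi> j * ((of_nat j + a) ^ l * y ^ j))" by simp
  also have "\<dots> = (\<Sum>j<2 * k. coeff \<psi> j * ((of_nat j + a) ^ l * y powi (i - int k + int j)))"
    unfolding sum_distrib_left using y(1) by (intro sum.cong refl) (simp add: power_int_add mult_ac)
  also have "\<dots> = flow (col_val c) i"
    unfolding cut_flow_def col_val_def yl coeff_psi a_def by (intro sum.cong refl) (simp add: algebra_simps)
  finally show ?thesis by simp
qed

text \<open>The pairs in \<open>colpairs\<close> are distinct, so the coefficients can be indexed by
  pairs instead of positions, which is what \<open>C\<close> does.\<close>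

lemma col_val_independent:
  assumes len: "np \<le> length colpairs" and zero: "\<And>e::nat. 1 \<le> e \<Longrightarrow> (\<Sum>b<np. x b * col_val b (int e)) = 0" and "b < np"
  shows "x b = 0"
proof -
  have inj: "inj_on ((!) colpairs) {..<np}"
    using distinct_root_cols[OF ys_distinct, of \<psi>] len by (auto simp: inj_on_def nth_eq_iff_index_eq)
  define S where "S = (!) colpairs ` {..<np}"
  define C where "C z = x (the_inv_into {..<np} ((!) colpairs) z)" for z
  have C: "C (colpairs ! b) = x b" if "b < np" for b
    using that inj by (simp add: C_def the_inv_into_f_f)
  have "C (fst (colpairs ! b), snd (colpairs ! b)) = 0"
  proof (rule exp_monomials_independent)
    show "finite S" by (simp add: S_def)
    show "y \<noteq> 0" if "(y, l) \<in> S" for y l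
      using that col_props(1) len unfolding S_def by (metis (no_types, lifting) fst_conv imageE lessThan_iff order_less_le_trans)
    show "(fst (colpairs ! b), snd (colpairs ! b)) \<in> S" using assms(3) by (simp add: S_def)
    fix e :: nat assume "1 \<le> e"
    have "(\<Sum>(y, l)\<in>S. C (y, l) * (of_nat e ^ l * y ^ e)) = (\<Sum>b<np. x b * col_val b (int e))"
      unfolding S_def sum.reindex[OF inj] by (intro sum.cong refl) (simp add: case_prod_beta C col_val_def)
    then show "(\<Sum>(y, l)\<in>S. C (y, l) * (of_nat e ^ l * y ^ e)) = 0" using zero \<open>1 \<le> e\<close> by simp
  qed
  then show ?thesis using C[OF assms(3)] by simp
qed

section \<open>Rows, kernel and cofactors of \<Omega>\<close>

abbreviation "\<Omega> \<equiv> Omega k p q ys"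

text \<open>The entries of \<open>x\<close> below \<open>np\<close> weight the columns of \<Psi>;
  \<open>- x np\<close> will be the value at state 0 of the invariant vector.\<close>

definition row_apply :: "(nat \<Rightarrow> complex) \<Rightarrow> nat \<Rightarrow> nat \<Rightarrow> complex" where
  "row_apply x i a = (\<Sum>b<Suc np. \<Omega> i $$ (a, b) * x b)"

definition col_comb :: "(nat \<Rightarrow> complex) \<Rightarrow> int \<Rightarrow> complex" where
  "col_comb x e = (\<Sum>b<np. x b * col_val b e)"

text \<open>If these rows vanish, the combination is 0 at the negative positions from
  \<open>2 - np\<close> on and equals \<open>- x np\<close> at 0: the side conditions of
  \<open>difference_invariant\<close>.\<close>

lemma row_apply_top:
  assumes "a + 1 < np"
  shows "row_apply x i a = col_comb x (int a + 2 - int np) + (if a + 2 = np then x np else 0)"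
  using assms unfolding row_apply_def col_comb_def
  by (simp add: Omega_def Let_def Psi_entry_eq algebra_simps)

text \<open>The row with the block of ones accumulates the increments, and so evaluates the
  invariant vector at state \<open>i\<close>.\<close>

lemma row_apply_middle:
  "row_apply x i (np - 1) = - x np + (\<Sum>e=1..i. col_comb x (int e))"
proof -
  have np: "1 \<le> np" using kp_props(1) by simp
  have "(\<Sum>m\<in>{np..<np + i}. col_val b (int m + 1 - int np)) = (\<Sum>e=1..i. col_val b (int e))" for b
    by (rule sum.reindex_bij_witness[of _ "\<lambda>e. e + np - 1" "\<lambda>m. m + 1 - np"]) (use np in \<open>auto simp: of_nat_diff add.commute\<close>)
  then have "row_apply x i (np - 1) = (\<Sum>b<np. (\<Sum>e=1..i. col_val b (int e)) * x b) - x np"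
    using np unfolding row_apply_def by (simp add: Omega_def Let_def Psi_entry_eq)
  also have "(\<Sum>b<np. (\<Sum>e=1..i. col_val b (int e)) * x b) = (\<Sum>e=1..i. col_comb x (int e))"
    unfolding col_comb_def sum_distrib_right by (subst sum.swap) (simp add: mult.commute)
  finally show ?thesis by simp
qed

lemma row_apply_bottom:
  "row_apply x i np = (\<Sum>j=np..leap_r k p q. of_real (eta k p q j) * col_comb x (int j + 1 - int np))
     + x np * of_real ((\<Sum>l=1..np. p l) - (\<Sum>l=1..nq. real l * q l))"
proof -
  have "row_apply x i np = (\<Sum>b<np. (\<Sum>j=np..leap_r k p q. of_real (eta k p q j) * col_val b (int j + 1 - int np)) * x b)
     + x np * of_real ((\<Sum>l=1..np. p l) - (\<Sum>l=1..nq. real l * q l))"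
    unfolding row_apply_def by (simp add: Omega_def Let_def Psi_entry_eq mult.commute)
  also have "(\<Sum>b<np. (\<Sum>j=np..leap_r k p q. of_real (eta k p q j) * col_val b (int j + 1 - int np)) * x b)
     = (\<Sum>j=np..leap_r k p q. of_real (eta k p q j) * col_comb x (int j + 1 - int np))"
    unfolding col_comb_def sum_distrib_right sum_distrib_left by (subst sum.swap) (simp add: mult_ac)
  finally show ?thesis .
qed

text \<open>Only row \<open>np - 1\<close> of \<open>\<Omega> i\<close> depends on \<open>i\<close>,
  so stating the other equations at 0 covers all \<open>i\<close>.\<close>

lemma kernel_invariant:
  assumes ker: "\<And>a. a < Suc np \<Longrightarrow> a \<noteq> np - 1 \<Longrightarrow> row_apply x 0 a = 0"
  shows "leap_invariant k p q (\<lambda>i. row_apply x i (np - 1))"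
    and "summable (\<lambda>i. cmod (row_apply x i (np - 1)))"
    and "(\<And>i. row_apply x i (np - 1) = 0) \<Longrightarrow> b < Suc np \<Longrightarrow> x b = 0"
proof -
  obtain \<rho> where \<rho>: "0 < \<rho>" "\<rho> < 1" and len: "np \<le> length colpairs"
    and small: "\<And>c. c < np \<Longrightarrow> cmod (fst (colpairs ! c)) < \<rho>"
    using decaying_columns by blast
  define w where "w = col_comb x"
  have eq: "(\<lambda>i. row_apply x i (np - 1)) = (\<lambda>i. - x np + (\<Sum>e=1..i. w (int e)))"
    unfolding row_apply_middle w_def ..
  show inv: "leap_invariant k p q (\<lambda>i. row_apply x i (np - 1))"
    unfolding eq
  proof (rule difference_invariant)
    have "flow w i = (\<Sum>b<np. x b * flow (col_val b) i)" for i
      unfolding cut_flow_def w_def col_comb_def sum_distrib_left by (subst sum.swap) (simp add: mult_ac)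
    then show "flow w i = 0" for i using flow_col_val len by simp
    have top: "w e = - (if e = 0 then x np else 0)" if "2 - int np \<le> e" "e \<le> 0" for e
    proof -
      \<comment> \<open>The 0-based row of \<Omega> that belongs to position
        \<open>e\<close>.\<close>
      define a where "a = nat (e + int np - 2)"
      have a: "int a + 2 - int np = e" "a + 1 < np" "a + 2 = np \<longleftrightarrow> e = 0" using that by (auto simp: a_def)
      then have "row_apply x 0 a = 0" by (intro ker) auto
      then show ?thesis using row_apply_top[OF a(2), of x 0] a by (simp add: w_def eq_neg_iff_add_eq_0)
    qed
    then show "w e = 0" if "2 - int np \<le> e" "e < 0" for e using that by simp
    show "w 0 = - x np" if "2 \<le> np" using top[of 0] that by simp
    have "row_apply x 0 np = 0" using kp_props(1) by (intro ker) auto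
    then show "(\<Sum>j=np..leap_r k p q. of_real (eta k p q j) * w (int j + 1 - int np))
      = - x np * of_real ((\<Sum>l=1..np. p l) - (\<Sum>l=1..nq. real l * q l))"
      unfolding row_apply_bottom w_def by (simp add: add_eq_0_iff2)
  qed
  have "\<exists>K. \<forall>e::nat. real e ^ snd (colpairs ! b) * cmod (fst (colpairs ! b)) ^ e \<le> K * \<rho> ^ e" if "b < np" for b
    using small[OF that] by (intro poly_exp_bound) auto
  then obtain K where K: "\<And>b e. b < np \<Longrightarrow> real e ^ snd (colpairs ! b) * cmod (fst (colpairs ! b)) ^ e \<le> K b * \<rho> ^ e"
    by metis
  have bound: "cmod (w (int e)) \<le> (\<Sum>b<np. cmod (x b) * K b) * \<rho> ^ e" for e
  proof -
    have "cmod (w (int e)) \<le> (\<Sum>b<np. cmod (x b * col_val b (int e)))"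
      unfolding w_def col_comb_def by (rule norm_sum)
    also have "\<dots> \<le> (\<Sum>b<np. cmod (x b) * (K b * \<rho> ^ e))"
      using K by (intro sum_mono) (auto simp: col_val_def norm_mult norm_power intro!: mult_left_mono)
    finally show ?thesis by (simp add: sum_distrib_right mult.assoc)
  qed
  show "summable (\<lambda>i. cmod (row_apply x i (np - 1)))"
    using difference_summable[OF _ _ \<rho> bound, of "- x np"] inv mu_neg unfolding fun_cong[OF eq] eq by simp
  assume zero: "\<And>i. row_apply x i (np - 1) = 0" and b: "b < Suc np"
  have \<sigma>: "- x np + (\<Sum>e=1..i. w (int e)) = 0" for i using zero fun_cong[OF eq, of i] by simp
  \<comment> \<open>\<open>w e\<close> is the difference of two consecutive values of the vector,
    both of them zero.\<close>
  have "w (int e) = 0" if "1 \<le> e" for e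
    using \<sigma>[of e] \<sigma>[of "e - 1"] that by (cases e) auto
  then have "x b = 0" if "b < np" for b
    using col_val_independent[OF len _ that, of x] by (auto simp: w_def col_comb_def)
  moreover have "x np = 0" using \<sigma>[of 0] by simp
  ultimately show "x b = 0" using b by (auto simp: less_Suc_eq)
qed

lemma Omega_carrier: "\<Omega> i \<in> carrier_mat (Suc np) (Suc np)"
  by (simp add: Omega_def Let_def)

lemma det_Omega_0: "det (\<Omega> 0) \<noteq> 0"
proof
  assume "det (\<Omega> 0) = 0"
  then obtain v where v: "v \<in> carrier_vec (Suc np)" "v \<noteq> 0\<^sub>v (Suc np)" "\<Omega> 0 *\<^sub>v v = 0\<^sub>v (Suc np)"
    using det_0_iff_vec_prod_zero[OF Omega_carrier] by blast
  define x where "x b = vec_index v b" for b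
  have ker: "row_apply x 0 a = 0" if "a < Suc np" for a
  proof -
    have "row_apply x 0 a = vec_index (\<Omega> 0 *\<^sub>v v) a"
      using that v(1) Omega_carrier[of 0]
      by (auto simp: row_apply_def x_def scalar_prod_def lessThan_atLeast0 intro!: sum.cong)
    then show ?thesis using v(3) that by simp
  qed
  \<comment> \<open>A kernel vector also annihilates row \<open>np - 1\<close> of
    \<open>\<Omega> 0\<close>, so the invariant vector vanishes at state 0 and thus
    everywhere.\<close>
  have "row_apply x i (np - 1) = 0" for i
    by (rule invariant_eq_0[OF kernel_invariant(1,2)[of x]]) (simp_all add: ker)
  then have "x b = 0" if "b < Suc np" for b using kernel_invariant(3)[of x] ker that by blast
  then have "v = 0\<^sub>v (Suc np)" using v(1) by (intro eq_vecI) (auto simp: x_def)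
  then show False using v(2) by simp
qed

lemma det_Omega_invariant:
  "leap_invariant k p q (\<lambda>i. det (\<Omega> i))" "summable (\<lambda>i. cmod (det (\<Omega> i)))"
proof -
  have np: "np - 1 < Suc np" by simp
  define x where "x b = cofactor (\<Omega> 0) (np - 1) b" for b
  \<comment> \<open>Deleting row \<open>np - 1\<close> removes all dependence on \<open>i\<close>,
    so every \<open>\<Omega> i\<close> has the same cofactors along it.\<close>
  have cof: "cofactor (\<Omega> i) (np - 1) b = x b" if "b < Suc np" for i b
    unfolding x_def cofactor_def
    by (intro arg_cong2[of _ _ _ _ "(*)"] refl arg_cong[of _ _ det] eq_matI)
       (auto simp: mat_delete_def Omega_def Let_def)
  have det: "det (\<Omega> i) = row_apply x i (np - 1)" for i
    unfolding laplace_expansion_row[OF Omega_carrier np] row_apply_def by (intro sum.cong refl) (simp only: lessThan_iff cof)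
  \<comment> \<open>Expanding one row by the cofactors of another gives an off-diagonal entry of a
    multiple of the identity.\<close>
  have ker: "row_apply x 0 a = 0" if "a < Suc np" "a \<noteq> np - 1" for a
  proof -
    have "row_apply x 0 a = (\<Omega> 0 * adj_mat (\<Omega> 0)) $$ (a, np - 1)"
      using that Omega_carrier[of 0]
      by (auto simp: row_apply_def x_def scalar_prod_def adj_mat_def lessThan_atLeast0 intro!: sum.cong)
    also have "\<dots> = 0" unfolding adj_mat(2)[OF Omega_carrier] using that by simp
    finally show ?thesis .
  qed
  show "leap_invariant k p q (\<lambda>i. det (\<Omega> i))" "summable (\<lambda>i. cmod (det (\<Omega> i)))"
    unfolding det using kernel_invariant(1,2)[OF ker] by blast+
qed

end

theorem mainTheorem8:
  fixes k :: nat and p q :: "nat \<Rightarrow> real" and ys :: "complex list"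
  assumes "1 \<le> k"
    and "\<forall>j\<in>{1..k}. 0 \<le> p j \<and> 0 \<le> q j"
    and "(\<Sum>j=1..k. p j + q j) = 1"
    and "(\<Sum>j=1..k. p j) > 0"
    and "(\<Sum>j=1..k. q j) > 0"
    and "Gcd {j\<in>{1..k}. p j + q j > 0} = 1"
    and "distinct ys"
    and "set ys = {z. z \<noteq> 0 \<and> poly (psi_poly k p q) z = 0}"
    and "sorted_wrt (\<lambda>a b. cmod a \<le> cmod b) ys"
  shows "(leap_mu k p q \<ge> 0 \<longrightarrow> \<not> (\<exists>\<pi>. leap_stationary k p q \<pi>))
       \<and> (leap_mu k p q < 0 \<longrightarrow>
            summable (\<lambda>j. det (Omega k p q ys j))
          \<and> (\<Sum>j. det (Omega k p q ys j)) \<noteq> 0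
          \<and> (\<exists>\<pi>. leap_stationary k p q \<pi>
                 \<and> (\<forall>i. complex_of_real (\<pi> i) = det (Omega k p q ys i) / (\<Sum>j. det (Omega k p q ys j))))
          \<and> (\<forall>\<pi>. leap_stationary k p q \<pi> \<longrightarrow>
                 (\<forall>i. complex_of_real (\<pi> i) = det (Omega k p q ys i) / (\<Sum>j. det (Omega k p q ys j)))))"
proof -
  interpret random_leap k p q using assms by unfold_locales auto
  show ?thesis
  proof (intro conjI impI)
    assume "leap_mu k p q \<ge> 0"
    then show "\<not> (\<exists>\<pi>. leap_stationary k p q \<pi>)" using stationary_imp_mu_neg by force
  next
    assume "leap_mu k p q < 0"
    then interpret random_leap_roots k p q ys using assms by unfold_locales auto
    note norm = invariant_normalizes[OF det_Omega_invariant det_Omega_0]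
    show "summable (\<lambda>j. det (Omega k p q ys j))" using det_Omega_invariant(2) by (rule summable_norm_cancel)
    show "(\<Sum>j. det (Omega k p q ys j)) \<noteq> 0" by (rule norm(1))
    show "\<exists>\<pi>. leap_stationary k p q \<pi>
        \<and> (\<forall>i. complex_of_real (\<pi> i) = det (Omega k p q ys i) / (\<Sum>j. det (Omega k p q ys j)))"
      using norm(2,3) by blast
    show "\<forall>\<pi>. leap_stationary k p q \<pi> \<longrightarrow>
        (\<forall>i. complex_of_real (\<pi> i) = det (Omega k p q ys i) / (\<Sum>j. det (Omega k p q ys j)))"
      using norm(3) by blast
  qed
qed

end
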